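(* The region arc shift move is an unknotting operation for twisted knots; that is, every twisted knot diagram can be transformed into a diagram of a trivial twisted knot by a finite sequence of region arc shift moves and extended Reidemeister moves.
   Context: **Twisted knots.** A twisted knot diagram is a generic closed oriented curve in $\mathbb{R}^2$ whose double points are each marked either as a classical crossing (with over/under information, hence a sign $\pm1$) or as a virtual crossing, and which carries finitely many bars (short transverse marks) placed on the curve away from the double points. Its Gauss diagram is an oriented circle parametrizing the curve, with one chord for each classical crossing joining its two preimages, directed from the over endpoint to the under endpoint and labelled with the sign, and with the bars recorded as marked points on the circle; virtual crossings are not recorded. Two diagrams are equivalent if they are related by planar isotopy and the extended Reidemeister moves: the classical moves $R_1,R_2,R_3$; the virtual moves $V_1,V_2,V_3,V_4$ (the Reidemeister moves with all crossings virtual, and the move passing a strand with only virtual crossings across a classical crossing); $T_1$ (a bar slides along its strand through a virtual crossing); $T_2$ (two adjacent bars on the same edge are created or deleted); and $T_3$ (whose effect on Gauss diagrams is: a chord has its direction reversed, its sign kept, and one bar is added on each of the four circle segments adjacent to its two endpoints, or the inverse). The moves $V_1$--$V_4,T_1$ do not change Gauss diagrams, and two diagrams are equivalent iff their Gauss diagrams are related by finitely many moves $R_1,R_2,R_3,T_2,T_3$ (no bars lie between the endpoints required to be adjacent in $R_1,R_2,R_3$). A twisted knot is an equivalence class of diagrams. A trivial twisted knot is the classical unknot (crossingless circle) with no bar or with one bar. **Arc shift move.** An arc $(a,b)$ of a diagram is a segment of the curve passing through exactly one pair of crossings $(c_1,c_2)$ (each classical or virtual), with end $a$ incident to $c_1$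 and end $b$ incident to $c_2$; bars may or may not lie between the two crossings. The arc shift move on $(a,b)$ cuts the arc at two points near $a$ and near $b$ and reconnects the four loose ends so that the middle piece is traversed in the opposite direction; the middle piece, with its bars and the over/under information at $c_1,c_2$, is left in place, and all newly created crossings are virtual. Effect on the Gauss diagram: the order along the knot of the two endpoints belonging to the arc is interchanged (bars between them remain between them), and the signs of those of $c_1,c_2$ that are classical are changed (for $c_1\ne c_2$). **Region arc shift (R.A.S.) move.** Let $D_G$ be the 4-valent plane graph obtained from a diagram $D$ by putting a vertex at each classical and virtual crossing. A region of $D$ is a connected component of $\mathbb{R}^2\setminus D_G$. The region arc shift move at a region $R$ applies the arc shift move once to each arc of the boundary of $R$ (one arc for each boundary edge, containing that edge and passing through its two end crossings). *)

theory Defs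
  imports "HOL-Combinatorics.Combinatorics"
begin

text \<open>
  Diagrams are encoded by cyclic words: one reads, along the oriented knot, the
  bars and the passages through the crossings. At a classical crossing the
  passage \<open>Pass c True\<close> is the over passage and \<open>Pass c False\<close> the under
  passage. At a virtual crossing the flag records the local picture instead: with the
  orientation of the plane, the direction of \<open>Pass c False\<close> is obtained from that
  of \<open>Pass c True\<close> by a counterclockwise turn.
  The kind of a crossing is either virtual or classical with a sign
  (\<open>True\<close> stands for \<open>+1\<close>); kinds of labels that do not occur in
  the word are irrelevant. The same type is used for Gauss diagrams, which are the codes
  all of whose crossings are classical: the two passages of a crossing are the endpoints
  of a chord directed from the over to the under passage.
\<close>

datatype letter = Bar | Pass (crossing: nat) (strand: bool)

datatype kind = Virtual | Classical bool

datatype knot_code = Code (word: "letter list") (kind: "nat \<Rightarrow> kind")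

definition passages :: "knot_code \<Rightarrow> letter list" where
  "passages D = filter (\<lambda>x. x \<noteq> Bar) (word D)"

definition crossings :: "knot_code \<Rightarrow> nat set" where
  "crossings D = {c. \<exists>b. Pass c b \<in> set (word D)}"

definition well_formed :: "knot_code \<Rightarrow> bool" where
  "well_formed D \<longleftrightarrow>
     distinct (passages D) \<and>
     (\<forall>c b. Pass c b \<in> set (word D) \<longrightarrow> Pass c (\<not> b) \<in> set (word D))"


subsection \<open>The underlying plane graph and its regions\<close>

fun mate :: "letter \<Rightarrow> letter" where
  "mate Bar = Bar"
| "mate (Pass c b) = Pass c (\<not> b)"

definition next_pass :: "knot_code \<Rightarrow> letter \<Rightarrow> letter" where
  "next_pass D = cycle_of_list (passages D)"

definition prev_pass :: "knot_code \<Rightarrow> letter \<Rightarrow> letter" where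
  "prev_pass D = inv (next_pass D)"

text \<open>
  Does the other strand go from the right to the left of the passage \<open>x\<close>? At a
  positive crossing the under strand goes to the left of the over strand, at a
  negative one to its right.
\<close>

definition mate_goes_left :: "knot_code \<Rightarrow> letter \<Rightarrow> bool" where
  "mate_goes_left D x \<longleftrightarrow>
     (case kind D (crossing x) of Virtual \<Rightarrow> strand x | Classical s \<Rightarrow> strand x = s)"

text \<open>
  The edges of the 4-valent graph are named by the passage at which they start, i.e. the
  edge \<open>x\<close> leads from \<open>x\<close> to \<open>next_pass D x\<close>; bars on an edge do not subdivide
  it. The dart \<open>(x, True)\<close> is this edge traversed along the orientation of the knot,
  \<open>(x, False)\<close> the same edge traversed backwards. \<open>face_step\<close> walks along the
  boundary of the region to the left of a dart, turning left at the crossing reached at the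
  end of the dart.
\<close>

definition darts :: "knot_code \<Rightarrow> (letter \<times> bool) set" where
  "darts D = set (passages D) \<times> UNIV"

fun face_step :: "knot_code \<Rightarrow> letter \<times> bool \<Rightarrow> letter \<times> bool" where
  "face_step D (x, True) =
     (let y = next_pass D x in
      if mate_goes_left D y then (mate y, True) else (prev_pass D (mate y), False))"
| "face_step D (x, False) =
     (if mate_goes_left D x then (prev_pass D (mate x), False) else (mate x, True))"

definition regions :: "knot_code \<Rightarrow> (letter \<times> bool) set set" where
  "regions D = orbit (face_step D) ` darts D"

text \<open>
  The graph is connected, so a code is the code of a curve in the plane (or on the sphere)
  iff Euler's formula \<open>V - E + F = 2\<close> holds; every passage starts one edge. The
  crossingless circle has no vertex and is treated separately. Up to isotopy, a diagram in the
  plane is such a code together with the choice of the unbounded region, which none of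
  the notions below refers to.
\<close>

definition planar :: "knot_code \<Rightarrow> bool" where
  "planar D \<longleftrightarrow>
     passages D = [] \<or>
     card (crossings D) + card (regions D) = length (passages D) + 2"

definition twisted_diagram :: "knot_code \<Rightarrow> bool" where
  "twisted_diagram D \<longleftrightarrow> well_formed D \<and> planar D"


subsection \<open>Gauss diagrams and equivalence\<close>

definition gauss :: "knot_code \<Rightarrow> knot_code" where
  "gauss D =
     Code (filter (\<lambda>x. x = Bar \<or> kind D (crossing x) \<noteq> Virtual) (word D)) (kind D)"

fun relabel :: "(nat \<Rightarrow> nat) \<Rightarrow> letter \<Rightarrow> letter" where
  "relabel f Bar = Bar"
| "relabel f (Pass c b) = Pass (f c) b"

text \<open>Equality of Gauss diagrams: base point and labels do not matter.\<close>

definition same_gauss :: "knot_code \<Rightarrow> knot_code \<Rightarrow> bool" where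
  "same_gauss G H \<longleftrightarrow>
     (\<exists>f n. inj_on f (crossings G) \<and>
            word H = rotate n (map (relabel f) (word G)) \<and>
            (\<forall>c \<in> crossings G. kind H (f c) = kind G c))"

text \<open>
  The third Reidemeister move has a top, a middle and a bottom strand. The chord \<open>a\<close>
  joins top and middle, \<open>b\<close> top and bottom, \<open>c\<close> middle and bottom, with
  signs \<open>p\<close>, \<open>q\<close>, \<open>r\<close>. For three oriented lines in general position whose
  crossings have these signs, the orders of the crossings on the three lines are those
  given below for one of the two values of \<open>h\<close>; the move, which passes one
  line over the intersection point of the other two, switches to the other value.
\<close>

definition top_strand where
  "top_strand h a b p q =
     (if (p = q) = h then [Pass b True, Pass a True] else [Pass a True, Pass b True])"

definition middle_strand where
  "middle_strand h a c p r =
     (if (p = r) = h then [Pass c True, Pass a False] else [Pass a False, Pass c True])"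

definition bottom_strand where
  "bottom_strand h b c q r =
     (if (q = r) = h then [Pass c False, Pass b False] else [Pass b False, Pass c False])"

inductive gauss_move :: "knot_code \<Rightarrow> knot_code \<Rightarrow> bool" where
  same: "same_gauss G H \<Longrightarrow> gauss_move G H"
| R1: "gauss_move (Code u k) (Code ([Pass c b, Pass c (\<not> b)] @ u) k)"
    if "c \<notin> crossings (Code u k)" "k c = Classical s"
| R2: "gauss_move (Code (u @ v) k) (Code ([Pass c True, Pass d True] @ u @ w @ v) k)"
    if "c \<noteq> d" "c \<notin> crossings (Code (u @ v) k)" "d \<notin> crossings (Code (u @ v) k)"
       "k c = Classical s" "k d = Classical (\<not> s)"
       "w = [Pass c False, Pass d False] \<or> w = [Pass d False, Pass c False]"
| R3_tmb:
    "gauss_move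
       (Code (top_strand h a b p q @ u @ middle_strand h a c p r @ v @
              bottom_strand h b c q r @ w) k)
       (Code (top_strand (\<not> h) a b p q @ u @ middle_strand (\<not> h) a c p r @ v @
              bottom_strand (\<not> h) b c q r @ w) k)"
    if "distinct [a, b, c]" "k a = Classical p" "k b = Classical q" "k c = Classical r"
| R3_tbm:
    "gauss_move
       (Code (top_strand h a b p q @ u @ bottom_strand h b c q r @ v @
              middle_strand h a c p r @ w) k)
       (Code (top_strand (\<not> h) a b p q @ u @ bottom_strand (\<not> h) b c q r @ v @
              middle_strand (\<not> h) a c p r @ w) k)"
    if "distinct [a, b, c]" "k a = Classical p" "k b = Classical q" "k c = Classical r"
| T2: "gauss_move (Code u k) (Code ([Bar, Bar] @ u) k)"
| T3: "gauss_move
         (Code ([Pass c True] @ u @ [Pass c False] @ v) k)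
         (Code ([Bar, Pass c False, Bar] @ u @ [Bar, Pass c True, Bar] @ v) k)"
    if "k c = Classical s"

text \<open>
  The moves \<open>V1\<close>--\<open>V4\<close> and \<open>T1\<close> only change a diagram within the set of
  diagrams with a given Gauss diagram. Hence equivalence under planar isotopy and all extended
  Reidemeister moves is expressed by the remaining moves on Gauss diagrams.
\<close>

definition reidemeister_equiv :: "knot_code \<Rightarrow> knot_code \<Rightarrow> bool" where
  "reidemeister_equiv D D' \<longleftrightarrow>
     twisted_diagram D \<and> twisted_diagram D' \<and> equivclp gauss_move (gauss D) (gauss D')"

definition trivial_knot_diagram :: "knot_code \<Rightarrow> bool" where
  "trivial_knot_diagram D \<longleftrightarrow>
     reidemeister_equiv D (Code [] (\<lambda>_. Virtual)) \<or>
     reidemeister_equiv D (Code [Bar] (\<lambda>_. Virtual))"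


subsection \<open>Arc shift and region arc shift\<close>

fun change_sign :: "kind \<Rightarrow> kind" where
  "change_sign Virtual = Virtual"
| "change_sign (Classical s) = Classical (\<not> s)"

text \<open>
  The arc shift on the arc with consecutive passages \<open>x\<close>, \<open>y\<close>. The virtual
  crossings created by the move are not listed and the flags of old virtual crossings are not
  adjusted, so only the Gauss diagram of the resulting code is meaningful.
\<close>

definition arc_shift :: "letter \<Rightarrow> letter \<Rightarrow> knot_code \<Rightarrow> knot_code" where
  "arc_shift x y D =
     Code (map (transpose x y) (word D))
       (if crossing x = crossing y then kind D
        else (kind D)
          (crossing x := change_sign (kind D (crossing x)),
           crossing y := change_sign (kind D (crossing y))))"

definition boundary_edges :: "(letter \<times> bool) set \<Rightarrow> letter set" where
  "boundary_edges R = fst ` R"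

text \<open>
  If a crossing meets a region with two opposite corners, two boundary arcs overlap in a
  passage and, once one of them is shifted, the other one is no longer an arc. The
  region arc shift is therefore performed only at regions whose boundary arcs
  \<open>(x, next_pass D x)\<close> have no passage in common; the order of the shifts is then
  immaterial. The result is any diagram with the resulting Gauss diagram: the new virtual
  crossings are determined up to \<open>V1\<close>--\<open>V4\<close> and \<open>T1\<close>.
\<close>

definition region_arc_shift :: "knot_code \<Rightarrow> knot_code \<Rightarrow> bool" where
  "region_arc_shift D D' \<longleftrightarrow>
     twisted_diagram D \<and> twisted_diagram D' \<and>
     (\<exists>R \<in> regions D. \<exists>xs.
        boundary_edges R \<inter> next_pass D ` boundary_edges R = {} \<and>
        distinct xs \<and> set xs = boundary_edges R \<and>
        same_gauss (gauss (fold (\<lambda>x. arc_shift x (next_pass D x)) xs D)) (gauss D'))"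

end

theory Submission
  imports Defs
begin

text \<open>
  A diagram may be exchanged for any other plane diagram with the same Gauss diagram. So, in order
  to change a Gauss diagram in a prescribed way, it suffices to exhibit one plane diagram
  that represents it and one region at which the region arc shift has the prescribed effect. A
  single picture supplies all that is needed.

  Let a horizontal strand pass first through \<open>x\<close> and then through \<open>y\<close>, two passages at
  different crossings. Let the two strands that cross it there also cross each other, virtually,
  once on either side of the horizontal strand. They then meet the horizontal strand in the opposite
  order, and the diagram remains plane. Two triangular regions have appeared, one on each side; the
  corners of each are the crossings of \<open>x\<close> and \<open>y\<close> and one of the new virtual crossings. The region
  arc shift at such a triangle shifts three arcs. Every corner lies on two of them, so that the signs
  change twice; one arc joins \<open>y\<close> to \<open>x\<close>, and its shift interchanges them; the two
  others join a passage to a virtual one, and their shifts do not affect the Gauss diagram. Hence the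
  region arc shift takes the modified diagram back to the Gauss diagram of the original one
  (\<open>strand_swap.region_arc_shift_undoes_swap\<close>). If, however, a bar lies on one of those two arcs,
  then it lies on the other side of the classical passage after the shift.

  Thus two operations on Gauss diagrams are available besides the Reidemeister moves: two
  neighbouring endpoints of different chords may be interchanged (\<open>reachable_swap_passages\<close>), and
  a bar may jump over an endpoint (\<open>reachable_bar_across_passage\<close>). With the second one all bars are
  gathered in one place, where \<open>T2\<close> leaves at most one of them; with the first one the two endpoints
  of every chord are brought together, and then \<open>R1\<close> removes all chords.

  The main labour is to see that the picture is plane, that is, that two crossings, four edges and
  two regions are gained. The regions are the orbits of a permutation of the half-edges. In order to
  compare the orbits before and after the change, each half-edge of either diagram, except those on the
  two triangles, is sent to a half-edge of the other one on the corresponding region;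
  \<open>card_orbits_eq\<close> then equates the numbers of orbits.

  Two preparations are necessary. Endpoints that are neighbours in the Gauss diagram may be separated by
  virtual crossings in the plane diagram, and the same interchange of strands moves these out of the way
  (\<open>make_passages_adjacent\<close>). For the jump of a bar the passage \<open>x\<close> needs a neighbour at another crossing;
  a virtual kink (\<open>virtual_kink\<close>) provides one.
\<close>

section \<open>Counting orbits\<close>

lemma self_in_orbit_of_finite_injection:
  assumes "finite S" "inj_on f S" "f ` S \<subseteq> S" "z \<in> S"
  shows "z \<in> orbit f z"
proof -
  define g where "g = (\<lambda>z. if z \<in> S then f z else z)"
  have "bij_betw f S S"
    using assms endo_inj_surj[of S f] by (auto simp: bij_betw_def)
  then have "bij_betw g S S"
    using bij_betw_cong[of S g f S] by (simp add: g_def)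
  then have "g permutes S"
    by (rule bij_imp_permutes) (simp add: g_def)
  then have "z \<in> orbit g z"
    by (intro permutation_self_in_orbit permutes_imp_permutation[OF assms(1)])
  moreover have "w \<in> orbit f z \<and> w \<in> S" if "w \<in> orbit g z" for w
    using that
  proof induction
    case base
    then show ?case using assms(3,4) by (auto simp: g_def intro: orbit.base)
  next
    case (step w)
    then show ?case using assms(3) by (auto simp: g_def intro: orbit.step)
  qed
  ultimately show ?thesis by blast
qed

lemma orbit_invariant:
  assumes "\<And>w. w \<in> S \<Longrightarrow> f w \<in> S \<and> h (f w) = h w" "z \<in> S" "w \<in> orbit f z"
  shows "w \<in> S \<and> h w = h z"
  using assms(3)
proof induction
  case base
  then show ?case using assms(1)[OF assms(2)] by simp
next
  case (step w)
  then show ?case using assms(1)[of w] by simp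
qed

lemma card_image_eq_of_same_fibres:
  assumes "\<And>z w. z \<in> S \<Longrightarrow> w \<in> S \<Longrightarrow> A z = A w \<longleftrightarrow> B z = B w"
  shows "card (A ` S) = card (B ` S)"
proof -
  have "bij_betw (\<lambda>X. B (inv_into S A X)) (A ` S) (B ` S)"
    unfolding bij_betw_def
  proof
    have *: "B (inv_into S A (A z)) = B z" if "z \<in> S" for z
      using assms[of "inv_into S A (A z)" z] that
        inv_into_into[of "A z" A S] f_inv_into_f[of "A z" A S] by blast
    show "inj_on (\<lambda>X. B (inv_into S A X)) (A ` S)"
      using * assms by (auto simp: inj_on_def)
    show "(\<lambda>X. B (inv_into S A X)) ` A ` S = B ` S"
      unfolding image_image using * by (rule image_cong[OF refl])
  qed
  then show ?thesis by (rule bij_betw_same_card)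
qed

text \<open>
  Two permutations have equally many orbits if there are maps in both directions that
  respect the orbits and are inverse to each other up to orbits. Neither map has to be a bijection, so
  that orbits may be lengthened, shortened and transplanted to another set.
\<close>

lemma card_orbits_eq:
  assumes fin: "finite S" "finite T"
    and f: "inj_on f S" "f ` S \<subseteq> S" and g: "inj_on g T" "g ` T \<subseteq> T"
    and \<pi>: "\<And>z. z \<in> S \<Longrightarrow> \<pi> z \<in> T" and \<iota>: "\<And>t. t \<in> T \<Longrightarrow> \<iota> t \<in> S"
    and \<pi>_step: "\<And>z. z \<in> S \<Longrightarrow> orbit g (\<pi> (f z)) = orbit g (\<pi> z)"
    and \<iota>_step: "\<And>t. t \<in> T \<Longrightarrow> orbit f (\<iota> (g t)) = orbit f (\<iota> t)"
    and \<iota>_\<pi>: "\<And>z. z \<in> S \<Longrightarrow> orbit f (\<iota> (\<pi> z)) = orbit f z"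
    and \<pi>_\<iota>: "\<And>t. t \<in> T \<Longrightarrow> orbit g (\<pi> (\<iota> t)) = orbit g t"
  shows "card (orbit f ` S) = card (orbit g ` T)"
proof -
  have self_f: "z \<in> orbit f z" if "z \<in> S" for z
    using self_in_orbit_of_finite_injection[OF fin(1) f] that .
  have self_g: "t \<in> orbit g t" if "t \<in> T" for t
    using self_in_orbit_of_finite_injection[OF fin(2) g] that .
  have "orbit f z = orbit f w \<longleftrightarrow> orbit g (\<pi> z) = orbit g (\<pi> w)" if "z \<in> S" "w \<in> S" for z w
  proof
    assume "orbit f z = orbit f w"
    then have "z \<in> orbit f w" using self_f that by auto
    from orbit_invariant[OF _ \<open>w \<in> S\<close> this, where h = "\<lambda>z. orbit g (\<pi> z)"] f(2) \<pi>_step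
    show "orbit g (\<pi> z) = orbit g (\<pi> w)" by blast
  next
    assume "orbit g (\<pi> z) = orbit g (\<pi> w)"
    then have "\<pi> z \<in> orbit g (\<pi> w)" using self_g[OF \<pi>] that by blast
    from orbit_invariant[OF _ \<pi>[OF \<open>w \<in> S\<close>] this, where h = "\<lambda>t. orbit f (\<iota> t)"] g(2) \<iota>_step
    have "orbit f (\<iota> (\<pi> z)) = orbit f (\<iota> (\<pi> w))" by blast
    then show "orbit f z = orbit f w" using \<iota>_\<pi> that by simp
  qed
  then have "card (orbit f ` S) = card ((\<lambda>z. orbit g (\<pi> z)) ` S)"
    by (rule card_image_eq_of_same_fibres)
  also have "(\<lambda>z. orbit g (\<pi> z)) ` S = orbit g ` T"
  proof
    show "(\<lambda>z. orbit g (\<pi> z)) ` S \<subseteq> orbit g ` T" using \<pi> by blast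
    show "orbit g ` T \<subseteq> (\<lambda>z. orbit g (\<pi> z)) ` S"
    proof
      fix R assume "R \<in> orbit g ` T"
      then obtain t where "t \<in> T" "R = orbit g (\<pi> (\<iota> t))" using \<pi>_\<iota> by blast
      then show "R \<in> (\<lambda>z. orbit g (\<pi> z)) ` S" using \<iota> by blast
    qed
  qed
  finally show ?thesis .
qed

section \<open>Cyclic words, half-edges and regions\<close>

text \<open>
  Appending the head of \<open>P\<close> to \<open>P\<close> makes the step from the last element back to the first
  one an instance of the general case.
\<close>

lemma cycle_of_list_successor:
  assumes "distinct P" "P @ [hd P] = A @ [a, b] @ B" "P \<noteq> []"
  shows "cycle_of_list P a = b"
proof -
  define i where "i = length A"
  have rot: "map (cycle_of_list P) P = rotate1 P"
    using cyclic_rotation[OF assms(1), of 1] by simp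
  have len: "length P = i + 1 + length B"
    using arg_cong[OF assms(2), of length] by (simp add: i_def)
  have a: "(P @ [hd P]) ! i = a" "(P @ [hd P]) ! Suc i = b"
    unfolding assms(2) by (simp_all add: i_def nth_append)
  have "P ! i = a" using a(1) len by (simp add: nth_append)
  moreover have "rotate1 P ! i = b"
  proof -
    obtain p ps where P: "P = p # ps" using assms(3) by (cases P) auto
    show ?thesis using a(2) by (simp add: P)
  qed
  ultimately show ?thesis
    using arg_cong[OF rot, of "\<lambda>l. l ! i"] len by simp
qed

lemma prev_next: "prev_pass D (next_pass D a) = a"
  unfolding prev_pass_def next_pass_def by (simp add: permutes_inverses(2)[OF cycle_permutes])

lemma next_pass_prev_pass:
  assumes "distinct (passages D)" "passages D @ [hd (passages D)] = A @ [a, b] @ B"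
  shows "next_pass D a = b" "prev_pass D b = a"
proof -
  have "passages D \<noteq> []"
  proof
    assume "passages D = []"
    then show False using arg_cong[OF assms(2), of length] by simp
  qed
  with assms show n: "next_pass D a = b"
    unfolding next_pass_def by (intro cycle_of_list_successor)
  with prev_next[of D a] show "prev_pass D b = a" by simp
qed

lemma next_prev: "next_pass D (prev_pass D a) = a"
  unfolding prev_pass_def next_pass_def by (simp add: permutes_inverses(1)[OF cycle_permutes])

lemma next_in_passages: "next_pass D a \<in> set (passages D) \<longleftrightarrow> a \<in> set (passages D)"
  unfolding next_pass_def by (simp add: permutes_in_image[OF cycle_permutes])

lemma prev_in_passages: "prev_pass D a \<in> set (passages D) \<longleftrightarrow> a \<in> set (passages D)"
  using next_in_passages[of D "prev_pass D a"] by (simp add: next_prev)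

lemma successor_split:
  assumes "a \<in> set P"
  shows "\<exists>A B b. P @ [hd P] = A @ [a, b] @ B"
proof -
  obtain A C where P: "P = A @ a # C" using assms by (meson split_list)
  show ?thesis
  proof (cases C)
    case Nil
    then have "P @ [hd P] = A @ [a, hd P] @ []" using P by simp
    then show ?thesis by blast
  next
    case (Cons b C')
    then have "P @ [hd P] = A @ [a, b] @ (C' @ [hd P])" using P by simp
    then show ?thesis by blast
  qed
qed

lemma mate_mate [simp]: "mate (mate x) = x"
  by (cases x) auto

lemma mate_eq_Bar [simp]: "mate x = Bar \<longleftrightarrow> x = Bar"
  by (cases x) auto

lemma mate_neq [simp]: "x \<noteq> Bar \<Longrightarrow> mate x \<noteq> x"
  by (cases x) auto

lemma mate_inject [simp]: "mate x = mate y \<longleftrightarrow> x = y"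
  by (metis mate_mate)

lemma crossing_eq_iff:
  "x \<noteq> Bar \<Longrightarrow> y \<noteq> Bar \<Longrightarrow> crossing x = crossing y \<longleftrightarrow> x = y \<or> x = mate y"
  by (cases x; cases y) auto

lemma crossing_mate [simp]: "x \<noteq> Bar \<Longrightarrow> crossing (mate x) = crossing x"
  by (cases x) auto

lemma mate_goes_left_mate [simp]:
  "x \<noteq> Bar \<Longrightarrow> mate_goes_left D (mate x) \<longleftrightarrow> \<not> mate_goes_left D x"
  by (cases x) (auto simp: mate_goes_left_def split: kind.split)

lemma set_passages: "set (passages D) = set (word D) - {Bar}"
  by (auto simp: passages_def)

lemma crossings_eq: "crossings D = crossing ` set (passages D)"
proof (intro set_eqI iffI)
  fix c assume "c \<in> crossings D"
  then obtain s where "Pass c s \<in> set (passages D)" by (auto simp: crossings_def set_passages)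
  then show "c \<in> crossing ` set (passages D)" by (rule rev_image_eqI) simp
next
  fix c assume "c \<in> crossing ` set (passages D)"
  then obtain z where z: "z \<in> set (passages D)" "c = crossing z" by blast
  show "c \<in> crossings D"
    by (cases z) (use z in \<open>auto simp: crossings_def set_passages\<close>)
qed

lemma finite_crossings [simp]: "finite (crossings D)"
  by (simp add: crossings_eq)

lemma Bar_notin_passages [simp]: "Bar \<notin> set (passages D)"
  by (simp add: set_passages)

lemma mate_in_passages [simp]:
  assumes "well_formed D"
  shows "mate x \<in> set (passages D) \<longleftrightarrow> x \<in> set (passages D)"
proof -
  have "mate z \<in> set (passages D)" if "z \<in> set (passages D)" for z
    using assms that by (cases z) (auto simp: well_formed_def set_passages)
  from this[of x] this[of "mate x"] show ?thesis by auto
qed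

lemma finite_darts: "finite (darts D)"
  by (simp add: darts_def)

text \<open>
  The pair \<open>(x, True)\<close> also serves as a name for the half-edge that leaves the crossing along
  the passage \<open>x\<close>, and \<open>(x, False)\<close> for the half-edge that arrives at it. Unlike the names of darts,
  these names do not refer to the neighbouring passage, so that a change of the diagram elsewhere does not
  affect them. A step along the boundary of a region consists of \<open>opposite_end\<close>, which follows the edge, and
  \<open>turn\<close>, which passes to the next half-edge on the left at the crossing where one arrives; only the
  former depends on the cyclic order of the passages.
\<close>

definition opposite_end :: "knot_code \<Rightarrow> letter \<times> bool \<Rightarrow> letter \<times> bool" where
  "opposite_end D h =
     (if snd h then (next_pass D (fst h), False) else (prev_pass D (fst h), True))"

definition turn :: "knot_code \<Rightarrow> letter \<times> bool \<Rightarrow> letter \<times> bool" where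
  "turn D h = (mate (fst h), mate_goes_left D (fst h) \<noteq> snd h)"

definition corner_step :: "knot_code \<Rightarrow> letter \<times> bool \<Rightarrow> letter \<times> bool" where
  "corner_step D h = turn D (opposite_end D h)"

lemma opposite_end_opposite_end [simp]: "opposite_end D (opposite_end D h) = h"
  by (cases h) (simp add: opposite_end_def prev_next next_prev)

lemma opposite_end_in_darts [simp]: "opposite_end D h \<in> darts D \<longleftrightarrow> h \<in> darts D"
  by (cases h) (auto simp: opposite_end_def darts_def next_in_passages prev_in_passages)

lemma turn_in_darts [simp]: "well_formed D \<Longrightarrow> turn D h \<in> darts D \<longleftrightarrow> h \<in> darts D"
  by (cases h) (simp add: turn_def darts_def)

lemma inj_on_turn: "inj_on (turn D) (darts D)"
proof (rule inj_onI)
  fix g h assume gh: "g \<in> darts D" "h \<in> darts D" "turn D g = turn D h"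
  then have "fst g = fst h" by (metis fst_conv mate_mate turn_def)
  moreover from this have "snd g = snd h" using gh(3) by (auto simp: turn_def)
  ultimately show "g = h" by (rule prod_eqI)
qed

lemma corner_step_darts: "well_formed D \<Longrightarrow> corner_step D ` darts D \<subseteq> darts D"
  by (auto simp: corner_step_def)

lemma inj_on_corner_step: "inj_on (corner_step D) (darts D)"
proof (rule inj_onI)
  fix g h assume gh: "g \<in> darts D" "h \<in> darts D" "corner_step D g = corner_step D h"
  then have "opposite_end D g = opposite_end D h"
    using inj_onD[OF inj_on_turn, of D "opposite_end D g" "opposite_end D h"]
    by (simp add: corner_step_def)
  then show "g = h" by (metis opposite_end_opposite_end)
qed

lemma orbit_corner_step:
  assumes "well_formed D" "h \<in> darts D"
  shows "orbit (corner_step D) (corner_step D h) = orbit (corner_step D) h"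
  using self_in_orbit_of_finite_injection
    [OF finite_darts inj_on_corner_step corner_step_darts[OF assms(1)] assms(2)]
  by (rule self_in_orbit_step)

text \<open>A dart corresponds to the half-edge at which it starts.\<close>

definition start_end :: "knot_code \<Rightarrow> letter \<times> bool \<Rightarrow> letter \<times> bool" where
  "start_end D d = (if snd d then d else (next_pass D (fst d), False))"

definition dart_from :: "knot_code \<Rightarrow> letter \<times> bool \<Rightarrow> letter \<times> bool" where
  "dart_from D h = (if snd h then h else (prev_pass D (fst h), False))"

lemma start_end_dart_from [simp]: "start_end D (dart_from D h) = h"
  by (cases h) (simp add: start_end_def dart_from_def next_prev)

lemma dart_from_start_end [simp]: "dart_from D (start_end D h) = h"
  by (cases h) (simp add: start_end_def dart_from_def prev_next)

lemma start_end_in_darts [simp]: "start_end D h \<in> darts D \<longleftrightarrow> h \<in> darts D"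
  by (cases h) (auto simp: start_end_def darts_def next_in_passages)

lemma dart_from_in_darts [simp]: "dart_from D h \<in> darts D \<longleftrightarrow> h \<in> darts D"
  by (cases h) (auto simp: dart_from_def darts_def prev_in_passages)

lemma face_step_eq:
  assumes "d \<in> darts D"
  shows "face_step D d = dart_from D (corner_step D (start_end D d))"
proof (cases d)
  case (Pair x b)
  show ?thesis
    by (cases b)
      (simp_all add: Pair Let_def dart_from_def corner_step_def turn_def opposite_end_def
        start_end_def prev_next)
qed

lemma card_regions:
  assumes wf: "well_formed D"
  shows "card (regions D) = card (orbit (corner_step D) ` darts D)"
  unfolding regions_def
proof (rule card_orbits_eq[where \<pi> = "start_end D" and \<iota> = "dart_from D"])
  let ?c = "corner_step D"
  have c: "?c h \<in> darts D" if "h \<in> darts D" for h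
    using corner_step_darts[OF wf] that by blast
  show "inj_on (face_step D) (darts D)"
  proof (rule inj_onI)
    fix d e assume *: "d \<in> darts D" "e \<in> darts D" "face_step D d = face_step D e"
    then have "?c (start_end D d) = ?c (start_end D e)"
      by (metis face_step_eq start_end_dart_from)
    then have "start_end D d = start_end D e"
      using inj_onD[OF inj_on_corner_step] * start_end_in_darts by blast
    then show "d = e" by (metis dart_from_start_end)
  qed
  show f: "face_step D ` darts D \<subseteq> darts D"
    by (auto simp: face_step_eq c)
  have self: "d \<in> orbit (face_step D) d" if "d \<in> darts D" for d
    by (rule self_in_orbit_of_finite_injection[OF finite_darts \<open>inj_on _ _\<close> f that])
  show "orbit ?c (start_end D (face_step D d)) = orbit ?c (start_end D d)"
    if "d \<in> darts D" for d
    using that by (simp add: face_step_eq orbit_corner_step[OF wf])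
  show "orbit (face_step D) (dart_from D (?c h)) = orbit (face_step D) (dart_from D h)"
    if "h \<in> darts D" for h
    using self_in_orbit_step[OF self, of "dart_from D h"] that by (simp add: face_step_eq)
qed (use wf in \<open>auto simp: finite_darts inj_on_corner_step corner_step_darts
      dest: corner_step_darts[THEN subsetD, OF _ imageI]\<close>)

text \<open>
  If every passage of \<open>D\<close> is replaced by a nonempty block of passages, then the edges of
  \<open>D\<close> survive as the edges between consecutive blocks. All modifications of diagrams below have
  this form.
\<close>

lemma next_pass_between_blocks:
  assumes "distinct (passages D)" "distinct (passages E)"
    and E: "passages E = concat (map F (passages D))"
    and F: "\<And>z. z \<in> set (passages D) \<Longrightarrow> F z \<noteq> []"
    and z: "z \<in> set (passages D)"
  shows "next_pass E (last (F z)) = hd (F (next_pass D z))"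
proof -
  let ?P = "passages D"
  obtain A B b where dec: "?P @ [hd ?P] = A @ [z, b] @ B"
    using successor_split[OF z] by blast
  then have b: "next_pass D z = b"
    using next_pass_prev_pass(1)[OF assms(1)] by blast
  then have "b \<in> set ?P" using z next_in_passages by blast
  then have nonempty: "F z \<noteq> []" "F b \<noteq> []" using F z by auto
  have hdE: "hd (passages E) = hd (F (hd ?P))"
    using z F by (cases ?P) (auto simp: E hd_append)
  have eq: "concat (map F ?P) @ F (hd ?P) = concat (map F A) @ F z @ F b @ concat (map F B)"
    using arg_cong[OF dec, of "\<lambda>l. concat (map F l)"] by simp
  obtain h t where ht: "F (hd ?P) = h # t"
    using F z by (cases ?P; cases "F (hd ?P)") auto
  have "\<exists>C. passages E @ [hd (passages E)] = concat (map F A) @ F z @ [hd (F b)] @ C"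
  proof (cases B rule: rev_cases)
    case Nil
    with dec have "?P = A @ [z]" "b = hd ?P" by auto
    then show ?thesis using hdE by (intro exI[of _ "[]"]) (simp add: E)
  next
    case (snoc B' c)
    with dec have P: "?P = A @ [z, b] @ B'" by simp
    have "passages E @ [hd (passages E)] =
        concat (map F A) @ F z @ F b @ concat (map F B') @ [hd (passages E)]"
      by (simp add: E P)
    also have "F b = [hd (F b)] @ tl (F b)" using nonempty by simp
    finally show ?thesis by auto
  qed
  then obtain C where "passages E @ [hd (passages E)] =
      (concat (map F A) @ butlast (F z)) @ [last (F z), hd (F b)] @ C"
    using append_butlast_last_id[OF nonempty(1)] by (metis append.assoc append_Cons append_Nil)
  then show ?thesis using next_pass_prev_pass(1)[OF assms(2)] b by blast
qed

lemma next_pass_within_block: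
  assumes "distinct (passages E)" "passages E = A @ [u, v] @ B"
  shows "next_pass E u = v" "prev_pass E v = u"
  using next_pass_prev_pass[OF assms(1), of A u v "B @ [hd (passages E)]"] assms(2) by auto

section \<open>Interchanging two consecutive passages\<close>

text \<open>
  The strand through \<open>x\<close> and \<open>y\<close> is thought of as running horizontally from left to right, so
  that its left side is the upper one. The numbers \<open>t\<close> (top) and \<open>b\<close> (bottom) label the two new virtual
  crossings of the strands through \<open>mate x\<close> and \<open>mate y\<close>.
\<close>

locale strand_swap =
  fixes x y :: letter and W :: "letter list" and k :: "nat \<Rightarrow> kind" and t b :: nat
  assumes wf: "well_formed (Code (x # y # W) k)"
    and proper: "x \<noteq> Bar" "y \<noteq> Bar" "crossing x \<noteq> crossing y"
    and fresh: "t \<noteq> b" "t \<notin> crossings (Code (x # y # W) k)"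
      "b \<notin> crossings (Code (x # y # W) k)"
begin

definition D where "D = Code (x # y # W) k"

definition \<alpha> where "\<alpha> \<longleftrightarrow> mate_goes_left D x"

definition \<beta> where "\<beta> \<longleftrightarrow> mate_goes_left D y"

text \<open>
  \<open>X s\<close> and \<open>Y s\<close> are the passages at the new crossing above (\<open>s = True\<close>) or below the horizontal
  strand that lie on the strand through \<open>mate x\<close> and on the one through \<open>mate y\<close>. As \<open>\<alpha>\<close> and
  \<open>\<beta>\<close> say whether these strands go upwards, the flags can be read off from a picture: below, the strand of
  \<open>y\<close> comes from the right of the strand of \<open>x\<close> iff both go in the same vertical direction;
  above it is the other way round.
\<close>

definition X where "X s = Pass (if s then t else b) ((\<alpha> = \<beta>) \<noteq> s)"

definition Y where "Y s = Pass (if s then t else b) ((\<alpha> = \<beta>) = s)"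

definition block where
  "block z =
     (if z = x then [y] else if z = y then [x]
      else if z = mate x then [X (\<not> \<alpha>), z, X \<alpha>]
      else if z = mate y then [Y (\<not> \<beta>), z, Y \<beta>] else [z])"

text \<open>
  The flags of \<open>X\<close> and \<open>Y\<close> at \<open>mate x\<close> and \<open>mate y\<close> reflect that a strand that
  goes upwards meets the lower crossing first. The blocks of \<open>x\<close> and \<open>y\<close> interchange the two
  passages.
\<close>

definition E where
  "E = Code (y # x # concat (map block W)) (k(t := Virtual, b := Virtual))"

text \<open>The inverse of \<open>block\<close>: the passage of \<open>D\<close> to whose block a passage of \<open>E\<close> belongs.\<close>

definition owner where
  "owner z =
     (if z = x then y else if z = y then x else if z \<in> range X then mate x
      else if z \<in> range Y then mate y else z)"

lemma wf_D: "well_formed D"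
  using wf by (simp add: D_def)

lemma distinct_D: "distinct (passages D)"
  using wf_D by (simp add: well_formed_def)

lemma mates [simp]:
  "x \<noteq> y" "y \<noteq> x" "mate x \<noteq> y" "y \<noteq> mate x" "x \<noteq> mate y" "mate y \<noteq> x" "mate x \<noteq> mate y"
  "Bar \<noteq> mate x" "Bar \<noteq> mate y" "mate y \<noteq> mate x" "mate x \<noteq> x" "x \<noteq> mate x" "mate y \<noteq> y" "y \<noteq> mate y"
  using proper by (cases x; cases y; auto)+

lemma X_Y_simps [simp]:
  "mate (X s) = Y s" "mate (Y s) = X s" "X s \<noteq> Y s'" "Y s' \<noteq> X s"
  "X s = X s' \<longleftrightarrow> s = s'" "Y s = Y s' \<longleftrightarrow> s = s'" "X s \<noteq> Bar" "Y s \<noteq> Bar" "Bar \<noteq> X s" "Bar \<noteq> Y s"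
  using fresh(1) by (auto simp: X_def Y_def)

lemma X_Y_fresh:
  "X s \<notin> set (x # y # W)" "Y s \<notin> set (x # y # W)"
  using fresh(2,3) by (auto simp: X_def Y_def crossings_def split: if_splits)

lemma x_y_in: "x \<in> set (passages D)" "y \<in> set (passages D)"
  using proper by (auto simp: D_def set_passages)

lemma mates_in: "mate x \<in> set (passages D)" "mate y \<in> set (passages D)"
  using x_y_in wf_D by simp_all

lemma in_word: "z \<in> set (passages D) \<Longrightarrow> z \<in> set (x # y # W)"
  by (auto simp: D_def set_passages)

lemma X_Y_not_in_D [simp]: "X s \<notin> set (passages D)" "Y s \<notin> set (passages D)"
  using X_Y_fresh in_word by blast+

lemma X_Y_neq_old:
  "z \<in> set (passages D) \<Longrightarrow> X s \<noteq> z \<and> z \<noteq> X s \<and> Y s \<noteq> z \<and> z \<noteq> Y s"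
  using X_Y_not_in_D by blast

lemmas X_Y_simps2 [simp] =
  x_y_in(1)[THEN X_Y_neq_old] x_y_in(2)[THEN X_Y_neq_old]
  mates_in(1)[THEN X_Y_neq_old] mates_in(2)[THEN X_Y_neq_old]

lemma not_in_W: "x \<notin> set W" "y \<notin> set W"
  using distinct_D proper by (auto simp: D_def passages_def)

lemma owner_block:
  assumes "z \<in> set (passages D)" "w \<in> set (block z)"
  shows "owner w = z"
  using assms by (auto simp: block_def owner_def split: if_splits)

lemma block_nonempty [simp]: "block z \<noteq> []"
  by (simp add: block_def)

lemma block_mate_x: "block (mate x) = [X (\<not> \<alpha>), mate x, X \<alpha>]"
  by (simp add: block_def)

lemma block_Bar: "block Bar = [Bar]"
  using proper by (simp add: block_def)

lemma distinct_block: "distinct (block z)"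
  by (auto simp: block_def)

lemma word_E: "word E = concat (map block (word D))"
  by (simp add: E_def D_def) (simp add: block_def)

lemma passages_E: "passages E = concat (map block (passages D))"
proof -
  have "filter (\<lambda>z. z \<noteq> Bar) (concat (map block V)) = concat (map block (filter (\<lambda>z. z \<noteq> Bar) V))"
    for V using proper by (induction V) (auto simp: block_def)
  then show ?thesis by (simp add: passages_def word_E)
qed

lemma distinct_E: "distinct (passages E)"
  unfolding passages_E
proof (rule distinct_concat)
  show "distinct (map block (passages D))"
    unfolding distinct_map
  proof (intro conjI distinct_D inj_onI)
    fix z w assume "z \<in> set (passages D)" "w \<in> set (passages D)" "block z = block w"
    then show "z = w" using owner_block[of z "hd (block z)"] owner_block[of w "hd (block z)"] by simp
  qed
  show "distinct ys" if "ys \<in> set (map block (passages D))" for ys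
    using that distinct_block by auto
  show "set ys \<inter> set zs = {}"
    if "ys \<in> set (map block (passages D))" "zs \<in> set (map block (passages D))" "ys \<noteq> zs" for ys zs
    using that owner_block by auto
qed

lemma set_passages_E: "set (passages E) = set (passages D) \<union> range X \<union> range Y"
proof -
  have range: "range f = {f c, f (\<not> c)}" for f :: "bool \<Rightarrow> letter" and c
    by (cases c) (auto simp: UNIV_bool)
  show ?thesis
    unfolding range[of X \<alpha>] range[of Y \<beta>]
    using x_y_in mates_in by (auto simp: passages_E block_def)
qed

lemma wf_E: "well_formed E"
proof -
  have "mate z \<in> set (passages E)" if "z \<in> set (passages E)" for z
    using that wf_D unfolding set_passages_E by auto
  from this[of "Pass c d" for c d] show ?thesis
    using distinct_E by (auto simp: well_formed_def set_passages)
qed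

lemma length_passages_E: "length (passages E) = length (passages D) + 4"
proof -
  have "length (passages E) = card (set (passages D) \<union> (range X \<union> range Y))"
    using distinct_card[OF distinct_E] set_passages_E by (simp add: Un_assoc)
  also have "\<dots> = card (set (passages D)) + card (range X \<union> range Y)"
    by (rule card_Un_disjoint) auto
  also have "card (range X \<union> range Y) = card (range X) + card (range Y)"
    by (rule card_Un_disjoint) auto
  also have "card (range X) = 2" by (subst card_image) (auto simp: inj_on_def)
  also have "card (range Y) = 2" by (subst card_image) (auto simp: inj_on_def)
  finally show ?thesis using distinct_card[OF distinct_D] by simp
qed

lemma mate_goes_left_D [simp]:
  "mate_goes_left D x \<longleftrightarrow> \<alpha>" "mate_goes_left D y \<longleftrightarrow> \<beta>"
  by (simp_all add: \<alpha>_def \<beta>_def)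

lemma mate_goes_left_E:
  "z \<in> set (passages D) \<Longrightarrow> mate_goes_left E z = mate_goes_left D z"
  "mate_goes_left E (X s) \<longleftrightarrow> (\<alpha> = \<beta>) \<noteq> s" "mate_goes_left E (Y s) \<longleftrightarrow> (\<alpha> = \<beta>) = s"
proof -
  assume "z \<in> set (passages D)"
  then have "crossing z \<in> crossings D" by (simp add: crossings_eq)
  then have "crossing z \<noteq> t \<and> crossing z \<noteq> b" using fresh(2,3) by (auto simp: D_def)
  then show "mate_goes_left E z = mate_goes_left D z"
    by (simp add: mate_goes_left_def E_def D_def)
qed (auto simp: mate_goes_left_def E_def X_def Y_def)

lemma turn_E:
  "h \<in> darts D \<Longrightarrow> turn E h = turn D h"
  "turn E (x, o1) = (mate x, \<alpha> \<noteq> o1)" "turn E (y, o1) = (mate y, \<beta> \<noteq> o1)"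
  "turn E (mate x, o1) = (x, \<alpha> = o1)" "turn E (mate y, o1) = (y, \<beta> = o1)"
  "turn E (X s, o1) = (Y s, ((\<alpha> = \<beta>) \<noteq> s) \<noteq> o1)" "turn E (Y s, o1) = (X s, ((\<alpha> = \<beta>) = s) \<noteq> o1)"
  using x_y_in mates_in proper by (auto simp: turn_def mate_goes_left_E darts_def)

text \<open>
  \<open>\<rho>\<close> sends a half-edge of \<open>D\<close> to the outer half-edge of the block that replaces its passage. It
  preserves edges; the half-edges of \<open>E\<close> that it misses are the eight ends of the four edges inside
  the blocks of \<open>mate x\<close> and \<open>mate y\<close>.
\<close>

definition \<rho> where
  "\<rho> h = ((if snd h then last (block (fst h)) else hd (block (fst h))), snd h)"

lemma \<rho>_simps [simp]:
  "\<rho> (x, o1) = (y, o1)" "\<rho> (y, o1) = (x, o1)"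
  "\<rho> (mate x, o1) = (X (o1 = \<alpha>), o1)" "\<rho> (mate y, o1) = (Y (o1 = \<beta>), o1)"
  by (cases o1; simp add: \<rho>_def block_def)+

lemma \<rho>_other: "z \<notin> {x, y, mate x, mate y} \<Longrightarrow> \<rho> (z, o1) = (z, o1)"
  by (auto simp: \<rho>_def block_def)

lemma opposite_end_\<rho>:
  assumes "h \<in> darts D"
  shows "opposite_end E (\<rho> h) = \<rho> (opposite_end D h)"
proof -
  have n: "next_pass E (last (block z)) = hd (block (next_pass D z))" if "z \<in> set (passages D)" for z
    using next_pass_between_blocks[OF distinct_D distinct_E passages_E _ that] by simp
  show ?thesis
  proof (cases "snd h")
    case True
    then show ?thesis using assms n[of "fst h"] by (auto simp: opposite_end_def \<rho>_def darts_def)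
  next
    case False
    have "prev_pass E (hd (block (next_pass D z))) = last (block z)"
      if "z \<in> set (passages D)" for z
      using n[OF that] prev_next[of E "last (block z)"] by simp
    from this[of "prev_pass D (fst h)"] show ?thesis
      using assms False by (auto simp: opposite_end_def \<rho>_def darts_def prev_in_passages next_prev)
  qed
qed

lemma passages_E_split:
  assumes "z \<in> set (passages D)"
  shows "\<exists>A B. passages E = A @ block z @ B"
proof -
  obtain A B where "passages D = A @ z # B" using assms by (meson split_list)
  then have "passages E = concat (map block A) @ block z @ concat (map block B)"
    by (simp add: passages_E)
  then show ?thesis by blast
qed

lemma next_pass_E:
  "next_pass E (X (\<not> \<alpha>)) = mate x" "next_pass E (mate x) = X \<alpha>"
  "next_pass E (Y (\<not> \<beta>)) = mate y" "next_pass E (mate y) = Y \<beta>"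
  "next_pass E y = x"
proof -
  obtain A B where "passages E = A @ [X (\<not> \<alpha>), mate x, X \<alpha>] @ B"
    using passages_E_split[OF mates_in(1)] by (auto simp: block_def)
  then show "next_pass E (X (\<not> \<alpha>)) = mate x" "next_pass E (mate x) = X \<alpha>"
    using next_pass_within_block(1)[OF distinct_E, of A "X (\<not> \<alpha>)" "mate x" "X \<alpha> # B"]
      next_pass_within_block(1)[OF distinct_E, of "A @ [X (\<not> \<alpha>)]" "mate x" "X \<alpha>" B] by simp_all
  obtain A B where "passages E = A @ [Y (\<not> \<beta>), mate y, Y \<beta>] @ B"
    using passages_E_split[OF mates_in(2)] by (auto simp: block_def)
  then show "next_pass E (Y (\<not> \<beta>)) = mate y" "next_pass E (mate y) = Y \<beta>"
    using next_pass_within_block(1)[OF distinct_E, of A "Y (\<not> \<beta>)" "mate y" "Y \<beta> # B"]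
      next_pass_within_block(1)[OF distinct_E, of "A @ [Y (\<not> \<beta>)]" "mate y" "Y \<beta>" B] by simp_all
  have "passages E = [] @ [y, x] @ filter (\<lambda>z. z \<noteq> Bar) (concat (map block W))"
    using proper by (simp add: passages_def E_def)
  then show "next_pass E y = x" using next_pass_within_block(1)[OF distinct_E] by blast
qed

lemma prev_pass_E:
  "prev_pass E (mate x) = X (\<not> \<alpha>)" "prev_pass E (X \<alpha>) = mate x"
  "prev_pass E (mate y) = Y (\<not> \<beta>)" "prev_pass E (Y \<beta>) = mate y"
  "prev_pass E x = y"
  using next_pass_E prev_next by metis+

lemma opposite_end_E:
  "opposite_end E (y, True) = (x, False)" "opposite_end E (x, False) = (y, True)"
  "opposite_end E (mate x, \<alpha>) = (X True, \<not> \<alpha>)" "opposite_end E (mate x, \<not> \<alpha>) = (X False, \<alpha>)"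
  "opposite_end E (mate y, \<beta>) = (Y True, \<not> \<beta>)" "opposite_end E (mate y, \<not> \<beta>) = (Y False, \<beta>)"
  using next_pass_E prev_pass_E by (cases \<alpha>; cases \<beta>; simp add: opposite_end_def)+

lemma opposite_end_E':
  "opposite_end E (X True, \<not> \<alpha>) = (mate x, \<alpha>)" "opposite_end E (X False, \<alpha>) = (mate x, \<not> \<alpha>)"
  "opposite_end E (Y True, \<not> \<beta>) = (mate y, \<beta>)" "opposite_end E (Y False, \<beta>) = (mate y, \<not> \<beta>)"
  using opposite_end_E(3-6) opposite_end_opposite_end by metis+

text \<open>
  The first three equations go round the triangle above the horizontal strand and the next three round the
  one below it. The last four concern the remaining inner half-edges, each of which is followed by
  one in the range of \<open>\<rho>\<close>.
\<close>

lemma corner_step_E: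
  "corner_step E (y, True) = (mate x, \<alpha>)" "corner_step E (mate x, \<alpha>) = (Y True, \<not> \<beta>)"
  "corner_step E (Y True, \<not> \<beta>) = (y, True)"
  "corner_step E (x, False) = (mate y, \<not> \<beta>)" "corner_step E (mate y, \<not> \<beta>) = (X False, \<alpha>)"
  "corner_step E (X False, \<alpha>) = (x, False)"
  "corner_step E (X True, \<not> \<alpha>) = \<rho> (y, True)" "corner_step E (mate y, \<beta>) = \<rho> (mate x, \<alpha>)"
  "corner_step E (mate x, \<not> \<alpha>) = \<rho> (mate y, \<not> \<beta>)" "corner_step E (Y False, \<beta>) = \<rho> (x, False)"
  unfolding corner_step_def opposite_end_E opposite_end_E' turn_E by auto

lemma corner_step_D:
  "corner_step D (x, True) = (mate y, \<beta>)" "corner_step D (y, False) = (mate x, \<not> \<alpha>)"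
proof -
  have "passages D = [] @ [x, y] @ filter (\<lambda>z. z \<noteq> Bar) W"
    using proper by (simp add: passages_def D_def)
  then have "next_pass D x = y" "prev_pass D y = x"
    using next_pass_within_block[OF distinct_D, of "[]"] by blast+
  then show "corner_step D (x, True) = (mate y, \<beta>)" "corner_step D (y, False) = (mate x, \<not> \<alpha>)"
    by (simp_all add: corner_step_def turn_def opposite_end_def)
qed

lemma opposite_end_D: "opposite_end D (x, True) = (y, False)"
proof -
  have "passages D = [] @ [x, y] @ filter (\<lambda>z. z \<noteq> Bar) W"
    using proper by (simp add: passages_def D_def)
  then show ?thesis
    using next_pass_within_block[OF distinct_D, of "[]" x y] by (simp add: opposite_end_def)
qed

text \<open>
  Away from the triangles the regions of \<open>D\<close> and \<open>E\<close> correspond to each other. The half-edges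
  \<open>(x, True)\<close> and \<open>(y, False)\<close> of \<open>D\<close> belong to the edge from \<open>x\<close> to \<open>y\<close>, whose image under
  \<open>\<rho>\<close> lies on the triangles; \<open>\<iota>\<close> sends them to the image of their successor instead. Likewise, \<open>\<pi>\<close> inverts
  \<open>\<rho>\<close> where possible and sends the four inner half-edges that do not lie on a triangle to the preimage of
  their successor.
\<close>

definition left_triangle where "left_triangle = {(y, True), (mate x, \<alpha>), (Y True, \<not> \<beta>)}"

definition right_triangle where "right_triangle = {(x, False), (mate y, \<not> \<beta>), (X False, \<alpha>)}"

definition outer where "outer = darts E - left_triangle - right_triangle"

definition \<pi> where
  "\<pi> h =
     (if h = (X True, \<not> \<alpha>) then (y, True) else if h = (mate y, \<beta>) then (mate x, \<alpha>)
      else if h = (mate x, \<not> \<alpha>) then (mate y, \<not> \<beta>) else if h = (Y False, \<beta>) then (x, False)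
      else (owner (fst h), snd h))"

definition \<iota> where
  "\<iota> h =
     (if h = (x, True) then \<rho> (mate y, \<beta>) else if h = (y, False) then \<rho> (mate x, \<not> \<alpha>) else \<rho> h)"

lemma darts_E_cases:
  assumes "h \<in> darts E"
  obtains "h \<in> left_triangle" | "h \<in> right_triangle"
  | "h \<in> {(X True, \<not> \<alpha>), (mate y, \<beta>), (mate x, \<not> \<alpha>), (Y False, \<beta>)}"
  | g where "g \<in> darts D" "g \<noteq> (x, True)" "g \<noteq> (y, False)" "h = \<rho> g"
proof -
  obtain z c where h: "h = (z, c)" by fastforce
  have z: "z \<in> set (passages D) \<union> range X \<union> range Y"
    using assms by (simp add: darts_def h set_passages_E)
  have D: "(x, c) \<in> darts D" "(y, c) \<in> darts D" "(mate x, c) \<in> darts D" "(mate y, c) \<in> darts D"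
    using x_y_in mates_in by (simp_all add: darts_def)
  consider "z = x" | "z = y" | "z = mate x" | "z = mate y" | s where "z = X s" | s where "z = Y s"
    | "z \<in> set (passages D)" "z \<notin> {x, y, mate x, mate y}"
    using z by auto
  then show thesis
  proof cases
    case 1
    then show ?thesis using that(4)[OF D(2)] that(2) by (cases c) (auto simp: h right_triangle_def)
  next
    case 2
    then show ?thesis using that(4)[OF D(1)] that(1) by (cases c) (auto simp: h left_triangle_def)
  next
    case 3
    then show ?thesis using that(1,3) by (cases "c = \<alpha>") (auto simp: h left_triangle_def)
  next
    case 4
    then show ?thesis using that(2,3) by (cases "c = \<beta>") (auto simp: h right_triangle_def)
  next
    case 5
    then show ?thesis using that(4)[OF D(3)] that(2,3)
      by (cases "s = (c = \<alpha>)"; cases s) (auto simp: h right_triangle_def)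
  next
    case 6
    then show ?thesis using that(4)[OF D(4)] that(1,3)
      by (cases "s = (c = \<beta>)"; cases s) (auto simp: h left_triangle_def)
  next
    case 7
    then show ?thesis using that(4)[of h] \<rho>_other[of z c] by (auto simp: h darts_def)
  qed
qed

lemma D_darts [simp]:
  "(x, c) \<in> darts D" "(y, c) \<in> darts D" "(mate x, c) \<in> darts D" "(mate y, c) \<in> darts D"
  using x_y_in mates_in by (simp_all add: darts_def)

lemma dart_D_cases:
  assumes "g \<in> darts D"
  obtains c where "g = (x, c)" | c where "g = (y, c)" | c where "g = (mate x, c)"
  | c where "g = (mate y, c)"
  | z c where "g = (z, c)" "z \<in> set (passages D)" "z \<notin> {x, y, mate x, mate y}"
  using assms by (cases g) (auto simp: darts_def)

lemma in_outer:
  assumes "g \<in> darts D" "g \<noteq> (x, True)" "g \<noteq> (y, False)"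
  shows "\<rho> g \<in> outer" "\<pi> (\<rho> g) = g"
proof -
  have "\<rho> g \<in> outer \<and> \<pi> (\<rho> g) = g"
    using assms(1)
  proof (cases rule: dart_D_cases)
    case (5 z c)
    then have "z \<notin> range X" "z \<notin> range Y" by auto
    with 5 show ?thesis
      by (auto simp: \<rho>_other outer_def left_triangle_def right_triangle_def darts_def set_passages_E \<pi>_def owner_def)
  qed (use assms in \<open>auto simp: outer_def left_triangle_def right_triangle_def darts_def set_passages_E \<pi>_def owner_def x_y_in\<close>)
  then show "\<rho> g \<in> outer" "\<pi> (\<rho> g) = g" by auto
qed

lemma extra_in_outer:
  "(X True, \<not> \<alpha>) \<in> outer" "(mate y, \<beta>) \<in> outer" "(mate x, \<not> \<alpha>) \<in> outer" "(Y False, \<beta>) \<in> outer"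
  using mates_in by (auto simp: outer_def left_triangle_def right_triangle_def darts_def set_passages_E)

lemma \<pi>_extra:
  "\<pi> (X True, \<not> \<alpha>) = (y, True)" "\<pi> (mate y, \<beta>) = (mate x, \<alpha>)"
  "\<pi> (mate x, \<not> \<alpha>) = (mate y, \<not> \<beta>)" "\<pi> (Y False, \<beta>) = (x, False)"
  by (auto simp: \<pi>_def)

lemma orbit_E: "h \<in> outer \<Longrightarrow> orbit (corner_step E) (corner_step E h) = orbit (corner_step E) h"
  by (intro orbit_corner_step[OF wf_E]) (simp add: outer_def)

lemma orbit_D:
  "h \<in> darts D \<Longrightarrow> orbit (corner_step D) (corner_step D h) = orbit (corner_step D) h"
  by (intro orbit_corner_step[OF wf_D])

text \<open>
  Since \<open>\<rho>\<close> preserves edges, it suffices to compare what happens when one arrives at a crossing. Six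
  half-edges lead into the part of the diagram that is changed; in \<open>D\<close> as well as in \<open>E\<close> the boundary walk that
  enters through one of them leaves through the next one.
\<close>

lemma turn_compare:
  assumes "g \<in> darts D" "g \<noteq> (x, True)" "g \<noteq> (y, False)"
  shows "turn E (\<rho> g) \<in> outer"
    "orbit (corner_step D) (\<pi> (turn E (\<rho> g))) = orbit (corner_step D) (turn D g)"
    "orbit (corner_step E) (\<iota> (turn D g)) = orbit (corner_step E) (turn E (\<rho> g))"
proof -
  note turn_D = turn_E(1)[symmetric, of "(x, _)"] turn_E(1)[symmetric, of "(y, _)"]
    turn_E(1)[symmetric, of "(mate x, _)"] turn_E(1)[symmetric, of "(mate y, _)"]
  let ?P = "turn E (\<rho> g) \<in> outer \<and>
    orbit (corner_step D) (\<pi> (turn E (\<rho> g))) = orbit (corner_step D) (turn D g) \<and>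
    orbit (corner_step E) (\<iota> (turn D g)) = orbit (corner_step E) (turn E (\<rho> g))"
  have ?P
    using assms(1)
  proof (cases rule: dart_D_cases)
    case (1 c)
    with assms have g: "g = (x, False)" by auto
    have "turn E (\<rho> g) = (mate y, \<beta>)" "turn D g = (mate x, \<alpha>)"
      by (auto simp: g turn_E turn_D)
    then show ?thesis
      using orbit_E[OF extra_in_outer(2)] extra_in_outer by (simp add: \<pi>_extra \<iota>_def corner_step_E)
  next
    case (2 c)
    with assms have g: "g = (y, True)" by auto
    have "turn E (\<rho> g) = (mate x, \<not> \<alpha>)" "turn D g = (mate y, \<not> \<beta>)"
      by (auto simp: g turn_E turn_D)
    then show ?thesis
      using orbit_E[OF extra_in_outer(3)] extra_in_outer by (simp add: \<pi>_extra \<iota>_def corner_step_E)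
  next
    case (3 c)
    show ?thesis
    proof (cases "c = \<alpha>")
      case True
      then have "turn E (\<rho> g) = \<rho> (mate y, \<beta>)" "turn D g = (x, True)"
        by (auto simp: 3 turn_E turn_D)
      moreover have "\<rho> (mate y, \<beta>) \<in> outer" "\<pi> (\<rho> (mate y, \<beta>)) = (mate y, \<beta>)"
        by (rule in_outer; simp)+
      ultimately show ?thesis
        using orbit_D[of "(x, True)"] by (simp add: \<iota>_def corner_step_D del: \<rho>_simps)
    next
      case False
      then have "turn E (\<rho> g) = (Y False, \<beta>)" "turn D g = (x, False)"
        by (auto simp: 3 turn_E turn_D)
      then show ?thesis
        using orbit_E[OF extra_in_outer(4)] extra_in_outer
        by (simp add: \<pi>_extra \<iota>_def corner_step_E del: \<rho>_simps)
    qed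
  next
    case (4 c)
    show ?thesis
    proof (cases "c = \<beta>")
      case True
      then have "turn E (\<rho> g) = (X True, \<not> \<alpha>)" "turn D g = (y, True)"
        by (auto simp: 4 turn_E turn_D)
      then show ?thesis
        using orbit_E[OF extra_in_outer(1)] extra_in_outer
        by (simp add: \<pi>_extra \<iota>_def corner_step_E del: \<rho>_simps)
    next
      case False
      then have "turn E (\<rho> g) = \<rho> (mate x, \<not> \<alpha>)" "turn D g = (y, False)"
        by (auto simp: 4 turn_E turn_D)
      moreover have "\<rho> (mate x, \<not> \<alpha>) \<in> outer" "\<pi> (\<rho> (mate x, \<not> \<alpha>)) = (mate x, \<not> \<alpha>)"
        by (rule in_outer; simp)+
      ultimately show ?thesis
        using orbit_D[of "(y, False)"] by (simp add: \<iota>_def corner_step_D del: \<rho>_simps)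
    qed
  next
    case (5 z c)
    then have m: "mate z \<notin> {x, y, mate x, mate y}" by auto
    have "turn D g = (mate z, snd (turn D g))" by (simp add: 5 turn_def)
    then have turn: "\<rho> (turn D g) = turn D g"
      using \<rho>_other[OF m] by metis
    have g: "\<rho> g = g" using 5 \<rho>_other by simp
    have ne: "turn D g \<noteq> (x, True)" "turn D g \<noteq> (y, False)"
      using m by (auto simp: turn_def 5)
    have "turn D g \<in> darts D" using assms wf_D by simp
    from in_outer[OF this ne] ne show ?thesis
      using turn_E(1)[OF assms(1)] by (simp add: g turn \<iota>_def)
  qed
  then show "turn E (\<rho> g) \<in> outer"
    "orbit (corner_step D) (\<pi> (turn E (\<rho> g))) = orbit (corner_step D) (turn D g)"
    "orbit (corner_step E) (\<iota> (turn D g)) = orbit (corner_step E) (turn E (\<rho> g))"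
    by auto
qed

lemma corner_step_compare:
  assumes "h \<in> darts D" "h \<noteq> (x, True)" "h \<noteq> (y, False)"
  shows "corner_step E (\<rho> h) \<in> outer"
    "orbit (corner_step D) (\<pi> (corner_step E (\<rho> h))) = orbit (corner_step D) h"
    "orbit (corner_step E) (\<iota> (corner_step D h)) = orbit (corner_step E) (\<rho> h)"
proof -
  let ?g = "opposite_end D h"
  have g: "?g \<in> darts D" "?g \<noteq> (x, True)" "?g \<noteq> (y, False)"
    using assms opposite_end_D opposite_end_opposite_end[of D h] opposite_end_opposite_end[of D "(x, True)"]
    by (auto simp del: opposite_end_opposite_end)
  have c: "corner_step E (\<rho> h) = turn E (\<rho> ?g)" "turn D ?g = corner_step D h"
    by (simp_all add: corner_step_def opposite_end_\<rho>[OF assms(1)])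
  show "corner_step E (\<rho> h) \<in> outer"
    "orbit (corner_step D) (\<pi> (corner_step E (\<rho> h))) = orbit (corner_step D) h"
    "orbit (corner_step E) (\<iota> (corner_step D h)) = orbit (corner_step E) (\<rho> h)"
    using turn_compare[OF g] orbit_D[OF assms(1)] orbit_E[OF in_outer(1)[OF assms]] by (simp_all add: c)
qed

lemma outer_cases:
  assumes "h \<in> outer"
  obtains "h \<in> {(X True, \<not> \<alpha>), (mate y, \<beta>), (mate x, \<not> \<alpha>), (Y False, \<beta>)}"
  | g where "g \<in> darts D" "g \<noteq> (x, True)" "g \<noteq> (y, False)" "h = \<rho> g"
  using assms darts_E_cases[of h] by (auto simp: outer_def)

lemma extra_step:
  assumes "h \<in> {(X True, \<not> \<alpha>), (mate y, \<beta>), (mate x, \<not> \<alpha>), (Y False, \<beta>)}"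
  shows "corner_step E h = \<rho> (\<pi> h)" "\<pi> h \<in> darts D" "\<pi> h \<noteq> (x, True)" "\<pi> h \<noteq> (y, False)"
  using assms by (auto simp: \<pi>_extra corner_step_E simp del: \<rho>_simps)

lemma outer_closed:
  assumes "h \<in> outer"
  shows "corner_step E h \<in> outer" "\<pi> h \<in> darts D"
proof -
  have "corner_step E h \<in> outer \<and> \<pi> h \<in> darts D"
    using assms
  proof (cases rule: outer_cases)
    case 1
    then show ?thesis using in_outer(1)[OF extra_step(2-4)[OF 1]] extra_step[OF 1] by simp
  next
    case (2 g)
    then show ?thesis using corner_step_compare(1)[OF 2(1-3)] in_outer(2)[OF 2(1-3)] by simp
  qed
  then show "corner_step E h \<in> outer" "\<pi> h \<in> darts D" by auto
qed

lemma card_orbits_outer: "card (orbit (corner_step E) ` outer) = card (orbit (corner_step D) ` darts D)"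
proof (rule card_orbits_eq[where \<pi> = \<pi> and \<iota> = \<iota>])
  show "finite outer" by (simp add: outer_def finite_darts)
  show "inj_on (corner_step E) outer"
    by (rule inj_on_subset[OF inj_on_corner_step]) (auto simp: outer_def)
  show "corner_step E ` outer \<subseteq> outer" using outer_closed(1) by blast
  show "\<pi> h \<in> darts D" if "h \<in> outer" for h
    using outer_closed(2)[OF that] .
  show "\<iota> g \<in> outer" if "g \<in> darts D" for g
    using that in_outer(1) by (auto simp: \<iota>_def simp del: \<rho>_simps)
  show "orbit (corner_step D) (\<pi> (corner_step E h)) = orbit (corner_step D) (\<pi> h)" if "h \<in> outer" for h
    using that
  proof (cases rule: outer_cases)
    case 1
    then show ?thesis using in_outer(2)[OF extra_step(2-4)[OF 1]] extra_step(1)[OF 1] by simp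
  next
    case (2 g)
    then show ?thesis using corner_step_compare(2)[OF 2(1-3)] in_outer(2)[OF 2(1-3)] by simp
  qed
  show "orbit (corner_step E) (\<iota> (corner_step D g)) = orbit (corner_step E) (\<iota> g)"
    if "g \<in> darts D" for g
  proof -
    consider "g = (x, True)" | "g = (y, False)" | "g \<noteq> (x, True)" "g \<noteq> (y, False)" by blast
    then show ?thesis
    proof cases
      case 3
      then show ?thesis using corner_step_compare(3)[OF that 3] by (simp add: \<iota>_def)
    qed (auto simp: corner_step_D \<iota>_def simp del: \<rho>_simps)
  qed
  show "orbit (corner_step E) (\<iota> (\<pi> h)) = orbit (corner_step E) h" if "h \<in> outer" for h
    using that
  proof (cases rule: outer_cases)
    case 1
    then show ?thesis using extra_step[OF 1] orbit_E[OF that] by (simp add: \<iota>_def)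
  next
    case (2 g)
    then show ?thesis using in_outer(2)[OF 2(1-3)] by (simp add: \<iota>_def)
  qed
  show "orbit (corner_step D) (\<pi> (\<iota> g)) = orbit (corner_step D) g" if "g \<in> darts D" for g
  proof -
    have "\<pi> (\<rho> (mate y, \<beta>)) = (mate y, \<beta>)" "\<pi> (\<rho> (mate x, \<not> \<alpha>)) = (mate x, \<not> \<alpha>)"
      by (rule in_outer; simp)+
    moreover consider "g = (x, True)" | "g = (y, False)" | "g \<noteq> (x, True)" "g \<noteq> (y, False)" by blast
    ultimately show ?thesis
      using orbit_D[of "(x, True)"] orbit_D[of "(y, False)"] in_outer(2)[OF that]
      by cases (simp_all add: \<iota>_def corner_step_D del: \<rho>_simps)
  qed
  show "finite (darts D)" by (rule finite_darts)
  show "inj_on (corner_step D) (darts D)" by (rule inj_on_corner_step)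
  show "corner_step D ` darts D \<subseteq> darts D" by (rule corner_step_darts[OF wf_D])
qed

lemma triangles_darts: "left_triangle \<subseteq> darts E" "right_triangle \<subseteq> darts E" "left_triangle \<inter> right_triangle = {}"
  using x_y_in mates_in by (auto simp: left_triangle_def right_triangle_def darts_def set_passages_E)

lemma orbit_left_triangle:
  assumes "h \<in> left_triangle"
  shows "orbit (corner_step E) h = orbit (corner_step E) (y, True)"
proof -
  have left: "(y, True) \<in> left_triangle" "(mate x, \<alpha>) \<in> left_triangle" by (simp_all add: left_triangle_def)
  note step = orbit_corner_step[OF wf_E triangles_darts(1)[THEN subsetD]]
  show ?thesis
    using assms step[OF left(1)] step[OF left(2)] unfolding left_triangle_def corner_step_E by blast
qed

lemma orbit_right_triangle:
  assumes "h \<in> right_triangle"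
  shows "orbit (corner_step E) h = orbit (corner_step E) (x, False)"
proof -
  have right: "(x, False) \<in> right_triangle" "(mate y, \<not> \<beta>) \<in> right_triangle" by (simp_all add: right_triangle_def)
  note step = orbit_corner_step[OF wf_E triangles_darts(2)[THEN subsetD]]
  show ?thesis
    using assms step[OF right(1)] step[OF right(2)] unfolding right_triangle_def corner_step_E by blast
qed

lemma card_regions_E: "card (regions E) = card (regions D) + 2"
proof -
  let ?o = "orbit (corner_step E)"
  have self: "h \<in> ?o h" if "h \<in> darts E" for h
    using self_in_orbit_of_finite_injection
      [OF finite_darts inj_on_corner_step corner_step_darts[OF wf_E] that] .
  have closed: "?o h \<subseteq> U" if "h \<in> U" "\<And>g. g \<in> U \<Longrightarrow> corner_step E g \<in> U" for h U
  proof
    fix g assume "g \<in> ?o h"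
    from orbit_invariant[of U "corner_step E" "\<lambda>_. ()", OF _ that(1) this] that(2)
    show "g \<in> U" by simp
  qed
  have in_T: "(y, True) \<in> left_triangle" "(x, False) \<in> right_triangle" by (simp_all add: left_triangle_def right_triangle_def)
  have left: "?o h \<subseteq> left_triangle" if "h \<in> left_triangle" for h
    using that
  proof (rule closed)
    show "corner_step E g \<in> left_triangle" if "g \<in> left_triangle" for g
      using that corner_step_E(1-3) unfolding left_triangle_def by auto
  qed
  have right: "?o h \<subseteq> right_triangle" if "h \<in> right_triangle" for h
    using that
  proof (rule closed)
    show "corner_step E g \<in> right_triangle" if "g \<in> right_triangle" for g
      using that corner_step_E(4-6) unfolding right_triangle_def by auto
  qed
  have outer: "?o h \<subseteq> outer" if "h \<in> outer" for h
    using closed[OF that outer_closed(1)] .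
  have ne: "?o (y, True) \<noteq> ?o (x, False)"
    using left[OF in_T(1)] right[OF in_T(2)] self[of "(y, True)"] in_T triangles_darts by blast
  have notin: "?o h \<notin> ?o ` outer" if "h \<in> left_triangle \<union> right_triangle" for h
  proof
    assume "?o h \<in> ?o ` outer"
    then obtain g where g: "g \<in> outer" "?o h = ?o g" by blast
    have "h \<in> ?o h" using that triangles_darts self by blast
    then have "h \<in> outer" using outer[OF g(1)] g(2) by blast
    then show False using that by (simp add: outer_def)
  qed
  have "darts E = left_triangle \<union> right_triangle \<union> outer" using triangles_darts by (auto simp: outer_def)
  then have "?o ` darts E = ?o ` left_triangle \<union> ?o ` right_triangle \<union> ?o ` outer" by (simp add: image_Un)
  moreover have "?o ` left_triangle = {?o (y, True)}" using orbit_left_triangle in_T(1) by blast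
  moreover have "?o ` right_triangle = {?o (x, False)}" using orbit_right_triangle in_T(2) by blast
  ultimately have "?o ` darts E = insert (?o (y, True)) (insert (?o (x, False)) (?o ` outer))"
    by (simp add: insert_commute)
  moreover have "finite (?o ` outer)" by (simp add: outer_def finite_darts)
  ultimately have "card (?o ` darts E) = card (?o ` outer) + 2"
    using ne notin[of "(y, True)"] notin[of "(x, False)"] in_T by simp
  then show ?thesis by (simp add: card_regions wf_D wf_E card_orbits_outer)
qed

lemma crossings_E: "crossings E = insert t (insert b (crossings D))"
proof -
  have "crossing ` range X \<union> crossing ` range Y = {t, b}"
    by (auto simp: X_def Y_def image_iff split: if_splits)
  then show ?thesis unfolding crossings_eq set_passages_E by (auto simp: image_Un)
qed

lemma planar_swap:
  assumes "planar D"
  shows "planar E"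
proof -
  have "card (crossings E) = card (crossings D) + 2"
    using fresh by (simp add: crossings_E D_def)
  moreover have "passages D \<noteq> []" using x_y_in by auto
  ultimately show ?thesis
    using assms by (simp add: planar_def card_regions_E length_passages_E)
qed

end

section \<open>Gauss diagrams and the region arc shift at a triangle\<close>

lemma orbit_three_cycle:
  assumes "f a = b" "f b = c" "f c = a"
  shows "orbit f a = {a, b, c}"
proof
  show "orbit f a \<subseteq> {a, b, c}"
  proof
    fix z assume "z \<in> orbit f a"
    then show "z \<in> {a, b, c}" by induction (use assms in auto)
  qed
  have "b \<in> orbit f a" using orbit.base[of f a] assms by simp
  moreover from this have "c \<in> orbit f a" using orbit.step[of b f a] assms by simp
  moreover from this have "a \<in> orbit f a" using orbit.step[of c f a] assms by simp
  ultimately show "{a, b, c} \<subseteq> orbit f a" by simp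
qed

lemma next_pass_rotate:
  assumes "distinct (passages D)" "passages C = rotate n (passages D)"
  shows "next_pass C = next_pass D"
  using cycle_of_list_rotate_independent[OF assms(1), of n] assms(2) by (simp add: next_pass_def)

lemma regions_cong:
  assumes "distinct (passages D)" "passages C = rotate n (passages D)" "kind C = kind D"
  shows "regions C = regions D"
proof -
  have "face_step C d = face_step D d" for d
  proof (cases d)
    case (Pair x b)
    then show ?thesis
      using next_pass_rotate[OF assms(1,2)] assms(3)
      by (cases b) (simp_all add: prev_pass_def mate_goes_left_def Let_def)
  qed
  then have "face_step C = face_step D" by blast
  then show ?thesis using assms(2) by (simp add: regions_def darts_def)
qed

lemma well_formed_eq:
  "well_formed D \<longleftrightarrow> distinct (passages D) \<and> (\<forall>z \<in> set (passages D). mate z \<in> set (passages D))"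
proof -
  have "(\<forall>c b. Pass c b \<in> set (word D) \<longrightarrow> Pass c (\<not> b) \<in> set (word D)) \<longleftrightarrow>
      (\<forall>z \<in> set (passages D). mate z \<in> set (passages D))"
    (is "?L \<longleftrightarrow> ?R")
  proof
    assume ?L
    show ?R
    proof
      fix z assume "z \<in> set (passages D)"
      with \<open>?L\<close> show "mate z \<in> set (passages D)" by (cases z rule: mate.cases) (auto simp: set_passages)
    qed
  next
    assume R: ?R
    show ?L
    proof (intro allI impI)
      fix c b assume "Pass c b \<in> set (word D)"
      with R[rule_format, of "Pass c b"] show "Pass c (\<not> b) \<in> set (word D)" by (simp add: set_passages)
    qed
  qed
  then show ?thesis by (simp add: well_formed_def)
qed

lemma twisted_diagram_cong:
  assumes "twisted_diagram D" "passages C = rotate n (passages D)" "kind C = kind D"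
  shows "twisted_diagram C"
proof -
  have "distinct (passages D)" using assms(1) by (simp add: twisted_diagram_def well_formed_def)
  from regions_cong[OF this assms(2,3)] show ?thesis
    using assms by (simp add: twisted_diagram_def planar_def well_formed_eq crossings_eq)
qed

definition gauss_word where
  "gauss_word k w = filter (\<lambda>z. z = Bar \<or> k (crossing z) \<noteq> Virtual) w"

lemma gauss_word_simps [simp]:
  "gauss_word k [] = []"
  "gauss_word k (z # w) =
     (if z = Bar \<or> k (crossing z) \<noteq> Virtual then z # gauss_word k w else gauss_word k w)"
  "gauss_word k (u @ w) = gauss_word k u @ gauss_word k w"
  by (simp_all add: gauss_word_def)

lemma crossings_gauss_word: "crossings (Code (gauss_word k w) k') \<subseteq> crossings (Code w k'')"
  by (auto simp: crossings_def gauss_word_def)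

lemma gauss_word_cong:
  assumes "\<And>z. z \<in> set w \<Longrightarrow> z \<noteq> Bar \<Longrightarrow> k (crossing z) = k' (crossing z)"
  shows "gauss_word k w = gauss_word k' w"
  unfolding gauss_word_def using assms by (intro filter_cong) auto

lemma gauss_eq: "gauss D = Code (gauss_word (kind D) (word D)) (kind D)"
  by (simp add: gauss_def gauss_word_def)

text \<open>The case of \<open>same_gauss\<close> without relabelling.\<close>

lemma same_gauss_refl:
  assumes "u = rotate n w" "\<And>c. c \<in> crossings (Code w k) \<Longrightarrow> k' c = k c"
  shows "same_gauss (Code w k) (Code u k')"
proof -
  have "map (relabel id) w = w"
  proof (rule map_idI)
    show "relabel id z = z" for z by (cases z) auto
  qed
  then show ?thesis
    unfolding same_gauss_def using assms by (intro exI[of _ id] exI[of _ n]) auto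
qed

lemma change_sign_change_sign [simp]: "change_sign (change_sign v) = v"
  by (cases v) auto

lemma twisted_diagram_rotate:
  assumes "twisted_diagram (Code (u @ w) k)"
  shows "twisted_diagram (Code (w @ u) k)"
  by (rule twisted_diagram_cong[OF assms, where n = "length (passages (Code u k))"])
    (simp_all add: passages_def rotate_append)

lemma gauss_word_eq_Nil_iff:
  "gauss_word k w = [] \<longleftrightarrow> (\<forall>z \<in> set w. z \<noteq> Bar \<and> k (crossing z) = Virtual)"
  by (auto simp: gauss_word_def filter_empty_conv)

lemma gauss_word_eq_ConsD:
  assumes "gauss_word k w = z # g"
  obtains A B where "w = A @ z # B" "gauss_word k A = []" "gauss_word k B = g"
    "z = Bar \<or> k (crossing z) \<noteq> Virtual"
  using assms unfolding gauss_word_def filter_eq_Cons_iff by (auto simp: filter_empty_conv)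

lemma gauss_word_eq_appendD:
  assumes "gauss_word k w = g @ h"
  shows "\<exists>u v. w = u @ v \<and> gauss_word k u = g \<and> gauss_word k v = h"
  using assms
proof (induction g arbitrary: w)
  case Nil
  then show ?case by (intro exI[of _ "[]"] exI[of _ w]) simp
next
  case (Cons z g)
  have "gauss_word k w = z # (g @ h)" using Cons.prems by simp
  then obtain A B where w: "w = A @ z # B" "gauss_word k A = []" "gauss_word k B = g @ h"
      "z = Bar \<or> k (crossing z) \<noteq> Virtual"
    by (rule gauss_word_eq_ConsD)
  from Cons.IH[OF w(3)] obtain u v where "B = u @ v" "gauss_word k u = g" "gauss_word k v = h"
    by blast
  then show ?case using w by (intro exI[of _ "A @ z # u"] exI[of _ v]) auto
qed

context strand_swap
begin

lemma kind_X_Y [simp]: "kind E (crossing (X s)) = Virtual" "kind E (crossing (Y s)) = Virtual"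
  by (simp_all add: E_def X_def Y_def)

lemma crossing_kind_E: "c \<in> crossings D \<Longrightarrow> kind E c = k c"
  using fresh(2,3) by (auto simp: D_def E_def)

lemma kind_E_old: "z \<in> set (passages D) \<Longrightarrow> kind E (crossing z) = k (crossing z)"
proof -
  assume "z \<in> set (passages D)"
  then have "crossing z \<in> crossings D" by (simp add: crossings_eq)
  then show ?thesis using fresh(2,3) by (auto simp: D_def E_def)
qed

lemma gauss_word_blocks:
  assumes "set V \<subseteq> set W"
  shows "gauss_word (kind E) (concat (map block V)) = gauss_word k V"
  using assms
proof (induction V)
  case (Cons z V)
  then have z: "z \<noteq> x" "z \<noteq> y" using not_in_W by auto
  have old: "kind E (crossing z) = k (crossing z)" if "z \<noteq> Bar"
    using kind_E_old[of z] that Cons.prems by (auto simp: D_def set_passages)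
  consider "z = mate x" | "z = mate y" | "z \<noteq> mate x" "z \<noteq> mate y" by blast
  then have "gauss_word (kind E) (block z) = gauss_word k [z]"
  proof cases
    case 1
    then show ?thesis using old proper by (simp add: block_def)
  next
    case 2
    then show ?thesis using old proper by (simp add: block_def)
  next
    case 3
    then show ?thesis using z old by (cases "z = Bar") (simp_all add: block_def)
  qed
  then show ?case using Cons by simp
qed simp

text \<open>
  Of the two triangles the one on the side to which the strand through \<open>mate x\<close> leads is chosen, so
  that its edge on that strand starts at \<open>mate x\<close>; this matters when a bar is put on that edge.
\<close>

lemma triangle_region:
  obtains R where "R \<in> regions E"
    "boundary_edges R = {y, mate x, if \<alpha> = \<beta> then mate y else Y \<alpha>}"
proof -
  have step: "face_step E (dart_from E h) = dart_from E (corner_step E h)" if "h \<in> darts E" for h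
    using that by (simp add: face_step_eq)
  have region: "{dart_from E a, dart_from E b, dart_from E c} \<in> regions E"
    if "corner_step E a = b" "corner_step E b = c" "corner_step E c = a"
      "a \<in> darts E" "b \<in> darts E" "c \<in> darts E" for a b c
  proof -
    have "orbit (face_step E) (dart_from E a) = {dart_from E a, dart_from E b, dart_from E c}"
      using that by (intro orbit_three_cycle) (simp_all add: step)
    then show ?thesis using that(4) unfolding regions_def
      by (metis dart_from_in_darts image_eqI)
  qed
  have in_E: "y \<in> set (passages E)" "x \<in> set (passages E)" "mate x \<in> set (passages E)"
    "mate y \<in> set (passages E)" "X s \<in> set (passages E)" "Y s \<in> set (passages E)" for s
    using x_y_in mates_in by (simp_all add: set_passages_E)
  show thesis
  proof (cases \<alpha>)
    case True
    let ?R = "{dart_from E (y, True), dart_from E (mate x, True), dart_from E (Y True, \<not> \<beta>)}"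
    have "?R \<in> regions E"
      using region[OF corner_step_E(1-3)] in_E by (simp add: True darts_def)
    moreover have "boundary_edges ?R = {y, mate x, if \<alpha> = \<beta> then mate y else Y \<alpha>}"
      using prev_pass_E(4) by (cases \<beta>) (simp_all add: boundary_edges_def dart_from_def True)
    ultimately show thesis by (rule that)
  next
    case False
    let ?R = "{dart_from E (x, False), dart_from E (mate y, \<not> \<beta>), dart_from E (X False, False)}"
    have "?R \<in> regions E"
      using region[OF corner_step_E(4-6)] in_E by (simp add: False darts_def)
    moreover have "boundary_edges ?R = {y, mate x, if \<alpha> = \<beta> then mate y else Y \<alpha>}"
      using prev_pass_E(2,3,5) by (cases \<beta>) (auto simp add: boundary_edges_def dart_from_def False)
    ultimately show thesis by (rule that)
  qed
qed

text \<open>The effect of the three arc shifts on the passages.\<close>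

definition shift where
  "shift = transpose (mate y) (Y \<alpha>) \<circ> transpose (mate x) (X \<alpha>) \<circ> transpose y x"

text \<open>
  The word \<open>V\<close> may have its bars in other places than the word of \<open>E\<close>; bars affect neither the plane
  graph nor the arcs.
\<close>

lemma region_arc_shift_at_triangle:
  assumes "passages (Code V (kind E)) = passages E" "twisted_diagram (Code V (kind E))"
    and "twisted_diagram C" "same_gauss (gauss (Code (map shift V) (kind E))) (gauss C)"
  shows "region_arc_shift (Code V (kind E)) C"
proof -
  let ?A = "Code V (kind E)" and ?z = "if \<alpha> = \<beta> then mate y else Y \<alpha>"
  have next_A: "next_pass ?A = next_pass E" using next_pass_rotate[OF distinct_E, of ?A 0] assms(1) by simp
  obtain R where R: "R \<in> regions E" "boundary_edges R = {y, mate x, ?z}"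
    by (rule triangle_region)
  have nz: "next_pass E ?z = (if \<alpha> = \<beta> then Y \<alpha> else mate y)"
    using next_pass_E(3,4) by auto
  have n: "next_pass E y = x" "next_pass E (mate x) = X \<alpha>" by (simp_all add: next_pass_E)
  have disj: "boundary_edges R \<inter> next_pass ?A ` boundary_edges R = {}"
    by (auto simp: R(2) next_A nz n split: if_splits)
  have "fold (\<lambda>z. arc_shift z (next_pass ?A z)) [y, mate x, ?z] ?A = Code (map shift V) (kind E)"
  proof -
    have "crossing (Y s) \<notin> crossings D" for s
      using fresh(2,3) by (auto simp: Y_def D_def)
    moreover have "crossing x \<in> crossings D" "crossing y \<in> crossings D"
      using x_y_in by (simp_all add: crossings_eq)
    ultimately have ne: "crossing (Y s) \<noteq> crossing x" "crossing (Y s) \<noteq> crossing y" for s by metis+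
    have cr: "crossing (X s) = crossing (Y s)" for s by (simp add: X_def Y_def)
    have 1: "arc_shift y x (Code V K) = Code (map (transpose y x) V)
        (K(crossing y := change_sign (K (crossing y)), crossing x := change_sign (K (crossing x))))"
      for V K using proper(3) by (simp add: arc_shift_def)
    have 2: "arc_shift (mate x) (X \<alpha>) (Code V K) = Code (map (transpose (mate x) (X \<alpha>)) V)
        (K(crossing x := change_sign (K (crossing x))))"
      if "K (crossing (Y \<alpha>)) = Virtual" for V K
      using that proper(1) ne[symmetric] ne by (simp add: arc_shift_def cr fun_upd_idem)
    have 3: "arc_shift ?z (next_pass E ?z) (Code V K) = Code (map (transpose (mate y) (Y \<alpha>)) V)
        (K(crossing y := change_sign (K (crossing y))))"
      if "K (crossing (Y \<alpha>)) = Virtual" for V K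
    proof -
      have K: "K(crossing (Y \<alpha>) := Virtual) = K" using that by (simp add: fun_upd_idem)
      show ?thesis
      proof (cases "\<alpha> = \<beta>")
        case True
        then show ?thesis
          using that K proper(2) ne(2)[of \<alpha>] ne(2)[of \<alpha>, symmetric]
          by (simp add: next_pass_E(4) arc_shift_def fun_upd_idem)
      next
        case False
        then show ?thesis
          using that K proper(2) ne(2)[of \<alpha>] ne(2)[of \<alpha>, symmetric]
          by (simp add: next_pass_E(3) arc_shift_def transpose_commute[of "Y (\<not> \<beta>)" "mate y"])
      qed
    qed
    \<comment> \<open>The signs of the crossings of x and y change twice.\<close>
    have 4: "K(crossing y := change_sign (K (crossing y)), crossing x := change_sign (K (crossing x)),
        crossing x := K (crossing x), crossing y := K (crossing y)) = K" for K :: "nat \<Rightarrow> kind"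
      by (rule ext) simp
    define third where "third = ?z"
    define K where "K = (kind E)(crossing y := change_sign (kind E (crossing y)),
        crossing x := change_sign (kind E (crossing x)))"
    have K: "K (crossing (Y \<alpha>)) = Virtual" "K (crossing x) = change_sign (kind E (crossing x))"
      "K (crossing y) = change_sign (kind E (crossing y))"
      using proper(3) ne[of \<alpha>] kind_X_Y(2)[of \<alpha>] by (simp_all add: K_def)
    have "fold (\<lambda>z. arc_shift z (next_pass ?A z)) [y, mate x, third] ?A =
        arc_shift third (next_pass E third) (arc_shift (mate x) (X \<alpha>) (arc_shift y x ?A))"
      by (simp add: next_A n)
    also have "\<dots> = Code (map shift V) (K(crossing x := kind E (crossing x), crossing y := kind E (crossing y)))"
      unfolding 1 K_def[symmetric] 2[of K, OF K(1)] third_def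
      using 3[of "K(crossing x := kind E (crossing x))"] K ne[of \<alpha>] proper(3)
      by (simp add: shift_def comp_assoc)
    also have "K(crossing x := kind E (crossing x), crossing y := kind E (crossing y)) = kind E"
      unfolding K_def by (rule 4)
    finally show ?thesis by (simp add: third_def)
  qed
  moreover have "R \<in> regions ?A" using R(1) regions_cong[OF distinct_E, of ?A 0] assms(1) by simp
  moreover have "distinct [y, mate x, ?z]" by auto
  ultimately show ?thesis
    unfolding region_arc_shift_def using assms disj R(2)
    by (intro conjI bexI[of _ R] exI[of _ "[y, mate x, ?z]"]) auto
qed

lemma shift_simps [simp]:
  "shift y = x" "shift x = y" "shift (mate x) = X \<alpha>" "shift (X \<alpha>) = mate x"
  "shift (mate y) = Y \<alpha>" "shift (Y \<alpha>) = mate y" "shift (X (\<not> \<alpha>)) = X (\<not> \<alpha>)"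
  "shift (Y (\<not> \<alpha>)) = Y (\<not> \<alpha>)" "shift Bar = Bar"
  using proper by (simp_all add: shift_def)

lemma shift_other: "z \<in> set (passages D) \<Longrightarrow> z \<notin> {x, y, mate x, mate y} \<Longrightarrow> shift z = z"
  using X_Y_neq_old[of z] by (auto simp: shift_def)

lemma gauss_word_shift_blocks:
  assumes "set V \<subseteq> set W"
  shows "gauss_word (kind E) (map shift (concat (map block V))) = gauss_word k V"
  using assms
proof (induction V)
  case (Cons z V)
  then have z: "z \<noteq> x" "z \<noteq> y" using not_in_W by auto
  have old: "kind E (crossing z) = k (crossing z)" if "z \<noteq> Bar"
    using kind_E_old[of z] that Cons.prems by (auto simp: D_def set_passages)
  have "gauss_word (kind E) (map shift (block z)) = gauss_word k [z]"
  proof (cases "z \<in> {Bar, mate x, mate y}")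
    case True
    have virtual: "gauss_word (kind E) (X s # w) = gauss_word (kind E) w"
      "gauss_word (kind E) (Y s # w) = gauss_word (kind E) w" for s w
      by simp_all
    consider "z = Bar" | "z = mate x" | "z = mate y" using True by blast
    then show ?thesis
    proof cases
      case 1
      then show ?thesis using proper by (simp add: block_def)
    next
      case 2
      then show ?thesis using old proper by (simp add: block_def)
    next
      case 3
      have "\<beta> = \<alpha> \<or> \<beta> = (\<not> \<alpha>)" by blast
      then show ?thesis using 3 old proper by (elim disjE) (simp_all add: block_def)
    qed
  next
    case False
    then have "shift z = z"
      using z Cons.prems by (intro shift_other) (auto simp: D_def set_passages)
    then show ?thesis using False z old by (simp add: block_def)
  qed
  then show ?case using Cons by simp
qed simp

lemma twisted_E:
  assumes "twisted_diagram D"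
  shows "twisted_diagram E"
  using assms wf_E planar_swap by (simp add: twisted_diagram_def)

text \<open>
  The blocks contain no bars, so the two arcs of the triangle other than the one from \<open>y\<close> to \<open>x\<close>
  have none, and their shifts only interchange \<open>mate x\<close> and \<open>mate y\<close> with virtual passages.
\<close>

lemma region_arc_shift_undoes_swap:
  assumes "twisted_diagram D"
  shows "region_arc_shift E D"
proof -
  have E: "E = Code (word E) (kind E)" by simp
  have "gauss_word (kind E) (map shift (word E)) = gauss_word k (x # y # W)"
  proof -
    have "word E = y # x # concat (map block W)" by (simp add: E_def)
    then show ?thesis
      using gauss_word_shift_blocks[of W] proper
      by (simp add: kind_E_old[OF x_y_in(1)] kind_E_old[OF x_y_in(2)])
  qed
  then have "gauss (Code (map shift (word E)) (kind E)) =
      Code (gauss_word k (x # y # W)) (kind E)"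
    unfolding gauss_eq knot_code.sel by (rule arg_cong)
  moreover have "gauss D = Code (gauss_word k (x # y # W)) k"
    unfolding gauss_eq D_def knot_code.sel ..
  moreover have "same_gauss (Code (gauss_word k (x # y # W)) (kind E))
      (Code (gauss_word k (x # y # W)) k)"
  proof (rule same_gauss_refl[where n = 0])
    fix c assume "c \<in> crossings (Code (gauss_word k (x # y # W)) (kind E))"
    then have "c \<in> crossings D"
      using crossings_gauss_word unfolding D_def by blast
    then show "k c = kind E c" using fresh(2,3) by (auto simp: D_def E_def)
  qed simp
  ultimately have "same_gauss (gauss (Code (map shift (word E)) (kind E))) (gauss D)"
    by (simp only:)
  then show ?thesis
    using region_arc_shift_at_triangle[of "word E" D] assms twisted_E[OF assms] by simp
qed

end

section \<open>Virtual kinks\<close>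

text \<open>
  Just after the passage \<open>x\<close> a loop with a virtual crossing is inserted. It adds one
  crossing, two edges and one region, which is bounded by a single edge.
\<close>

locale virtual_kink =
  fixes x :: letter and W :: "letter list" and k :: "nat \<Rightarrow> kind" and c :: nat
  assumes wf: "well_formed (Code (x # W) k)"
    and proper: "x \<noteq> Bar"
    and fresh: "c \<notin> crossings (Code (x # W) k)"
begin

definition D where "D = Code (x # W) k"

definition E where "E = Code (x # Pass c True # Pass c False # W) (k(c := Virtual))"

abbreviation "v \<equiv> Pass c True"

abbreviation "v' \<equiv> Pass c False"

definition block where "block z = (if z = x then [x, v, v'] else [z])"

lemma wf_D: "well_formed D"
  using wf by (simp add: D_def)

lemma distinct_D: "distinct (passages D)"
  using wf_D by (simp add: well_formed_def)

lemma v_fresh: "v \<notin> set (x # W)" "v' \<notin> set (x # W)"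
  using fresh unfolding crossings_def by auto

lemma v_neq [simp]: "v \<noteq> x" "v' \<noteq> x" "x \<noteq> v" "x \<noteq> v'"
  using v_fresh by auto

lemma passages_D: "passages D = x # passages (Code W k)"
  using proper by (simp add: passages_def D_def)

lemma passages_E: "passages E = x # v # v' # passages (Code W k)"
  using proper by (simp add: passages_def E_def)

lemma v_notin_D [simp]: "v \<notin> set (passages D)" "v' \<notin> set (passages D)"
  using v_fresh by (auto simp: set_passages D_def)

lemma x_in_D [simp]: "x \<in> set (passages D)"
  by (simp add: passages_D)

lemma distinct_E: "distinct (passages E)"
  using distinct_D v_notin_D by (simp add: passages_D passages_E)

lemma passages_E_blocks: "passages E = concat (map block (passages D))"
proof -
  have "concat (map block V) = V" if "x \<notin> set V" for V
    using that by (induction V) (auto simp: block_def)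
  from this[of "passages (Code W k)"] show ?thesis
    using distinct_D by (simp add: passages_D passages_E block_def)
qed

lemma set_passages_E: "set (passages E) = {v, v'} \<union> set (passages D)"
  by (auto simp: passages_D passages_E)

lemma wf_E: "well_formed E"
  using distinct_E wf_D by (auto simp: well_formed_eq set_passages_E)

lemma mate_goes_left_E: "z \<in> set (passages D) \<Longrightarrow> mate_goes_left E z = mate_goes_left D z"
proof -
  assume "z \<in> set (passages D)"
  then have "crossing z \<in> crossings D" by (simp add: crossings_eq)
  then have "crossing z \<noteq> c" using fresh by (auto simp: D_def)
  then show ?thesis by (simp add: mate_goes_left_def E_def D_def)
qed

lemma turn_E:
  "h \<in> darts D \<Longrightarrow> turn E h = turn D h"
  "turn E (v, s) = (v', \<not> s)" "turn E (v', s) = (v, s)"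
  by (auto simp: turn_def mate_goes_left_E darts_def) (simp_all add: mate_goes_left_def E_def)

text \<open>
  The edge that left \<open>x\<close> now leaves \<open>v'\<close>; \<open>\<rho>\<close> identifies the old half-edges accordingly.
\<close>

definition \<rho> where "\<rho> h = (if h = (x, True) then (v', True) else h)"

lemma opposite_end_\<rho>:
  assumes "h \<in> darts D"
  shows "opposite_end E (\<rho> h) = \<rho> (opposite_end D h)"
proof -
  obtain z s where h: "h = (z, s)" by fastforce
  have z: "z \<in> set (passages D)" using assms by (simp add: h darts_def)
  have n: "next_pass E (last (block z)) = hd (block (next_pass D z))" if "z \<in> set (passages D)" for z
    using next_pass_between_blocks[OF distinct_D distinct_E passages_E_blocks _ that]
    by (simp add: block_def)
  have last: "last (block z) = (if z = x then v' else z)" and hd: "hd (block z) = z" for z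
    by (simp_all add: block_def)
  show ?thesis
  proof (cases s)
    case True
    then show ?thesis using n[OF z]
      by (simp add: h opposite_end_def \<rho>_def last hd split: if_splits)
  next
    case False
    have "prev_pass E (next_pass D z) = last (block z)" if "z \<in> set (passages D)" for z
      using n[OF that] prev_next[of E "last (block z)"] by (simp add: hd)
    from this[of "prev_pass D z"] z show ?thesis
      using False by (simp add: h opposite_end_def \<rho>_def last prev_in_passages next_prev)
  qed
qed

lemma next_pass_E: "next_pass E x = v" "prev_pass E v = x" "next_pass E v = v'" "prev_pass E v' = v"
  using next_pass_within_block[OF distinct_E, of "[]" x v] passages_E
    next_pass_within_block[OF distinct_E, of "[x]" v v'] by auto

lemma corner_step_E:
  "corner_step E (v', False) = (v', False)" "corner_step E (x, True) = (v', True)"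
  "corner_step E (v, True) = (v, False)" "corner_step E (v, False) = turn D (x, True)"
  by (simp_all add: corner_step_def opposite_end_def next_pass_E turn_E darts_def)

definition outer where "outer = darts E - {(v', False)}"

lemma outer_eq: "outer = darts D \<union> {(v, True), (v, False), (v', True)}"
  by (auto simp: outer_def darts_def set_passages_E)

text \<open>
  Both half-edges at \<open>v\<close> lie on the region to the right of the edge from \<open>x\<close> to \<open>v\<close>; its boundary
  continues as that of the region to the right of the edge that left \<open>x\<close> in \<open>D\<close>.
\<close>

definition \<pi> where
  "\<pi> h = (if h = (v', True) then (x, True) else if fst h = v then turn D (x, True) else h)"

lemma \<pi>_id: "h \<in> darts D \<Longrightarrow> \<pi> h = h"
  using v_notin_D by (auto simp: \<pi>_def darts_def)

lemma orbit_E: "h \<in> outer \<Longrightarrow> orbit (corner_step E) (corner_step E h) = orbit (corner_step E) h"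
  by (intro orbit_corner_step[OF wf_E]) (simp add: outer_def)

lemma orbit_D:
  "h \<in> darts D \<Longrightarrow> orbit (corner_step D) (corner_step D h) = orbit (corner_step D) h"
  by (intro orbit_corner_step[OF wf_D])

lemma turn_D_x: "turn D (x, True) \<in> darts D" "turn D (x, True) \<noteq> (x, True)"
  using wf_D proper by (simp_all add: darts_def turn_def)

lemma orbit_E_\<rho>:
  assumes "h \<in> darts D"
  shows "\<rho> h \<in> outer" "orbit (corner_step E) (\<rho> h) = orbit (corner_step E) h"
  using assms orbit_E[of "(x, True)"] by (auto simp: \<rho>_def outer_eq corner_step_E darts_def)

lemma turn_compare:
  assumes "g \<in> darts D"
  shows "turn E (\<rho> g) \<in> outer"
    "\<pi> (turn E (\<rho> g)) = turn D g"
    "orbit (corner_step E) (\<rho> (turn D g)) = orbit (corner_step E) (turn E (\<rho> g))"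
proof -
  have "turn E (\<rho> g) \<in> outer \<and> \<pi> (turn E (\<rho> g)) = turn D g \<and>
    orbit (corner_step E) (\<rho> (turn D g)) = orbit (corner_step E) (turn E (\<rho> g))"
  proof (cases "g = (x, True)")
    case True
    then have "turn E (\<rho> g) = (v, True)" by (simp add: \<rho>_def turn_E)
    moreover have "orbit (corner_step E) (turn D (x, True)) = orbit (corner_step E) (v, True)"
      using orbit_E[of "(v, True)"] orbit_E[of "(v, False)"] by (simp add: outer_eq corner_step_E)
    ultimately show ?thesis
      using turn_D_x True by (simp add: outer_eq \<pi>_def \<rho>_def)
  next
    case False
    then have "turn E (\<rho> g) = turn D g" "turn D g \<in> darts D"
      using assms wf_D by (simp_all add: \<rho>_def turn_E)
    then show ?thesis using orbit_E_\<rho>(2) by (simp add: outer_eq \<pi>_id)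
  qed
  then show "turn E (\<rho> g) \<in> outer"
    "\<pi> (turn E (\<rho> g)) = turn D g"
    "orbit (corner_step E) (\<rho> (turn D g)) = orbit (corner_step E) (turn E (\<rho> g))"
    by simp_all
qed

lemma corner_step_compare:
  assumes "h \<in> darts D"
  shows "corner_step E (\<rho> h) \<in> outer" "\<pi> (corner_step E (\<rho> h)) = corner_step D h"
    "orbit (corner_step E) (\<rho> (corner_step D h)) = orbit (corner_step E) (\<rho> h)"
  using turn_compare[of "opposite_end D h"] assms orbit_E[OF orbit_E_\<rho>(1)[OF assms]]
  by (simp_all add: corner_step_def opposite_end_\<rho>)

lemma outer_cases:
  assumes "h \<in> outer"
  obtains "h = (v, True)" | "h = (v, False)" | "h = (x, True)"
  | g where "g \<in> darts D" "h = \<rho> g"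
proof -
  have "h \<in> darts D \<or> h \<in> {(v, True), (v, False), (v', True)}" using assms outer_eq by blast
  moreover have "\<rho> h = h" if "h \<noteq> (x, True)" using that by (simp add: \<rho>_def)
  moreover have "\<rho> (x, True) = (v', True)" "(x, True) \<in> darts D" by (simp_all add: \<rho>_def darts_def)
  ultimately show thesis using that by (metis insertE singletonD)
qed

lemma card_orbits_outer: "card (orbit (corner_step E) ` outer) = card (orbit (corner_step D) ` darts D)"
proof (rule card_orbits_eq[where \<pi> = \<pi> and \<iota> = \<rho>])
  have xD: "(x, True) \<in> darts D" by (simp add: darts_def)
  have in_outer: "(v, False) \<in> outer" "(v', True) \<in> outer" by (simp_all add: outer_eq)
  have \<pi>_v: "\<pi> (v, s) = turn D (x, True)" "\<pi> (v', True) = (x, True)" for s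
    by (simp_all add: \<pi>_def)
  have \<pi>_\<rho>: "\<pi> (\<rho> g) = g" if "g \<in> darts D" for g
    using that \<pi>_id by (simp add: \<rho>_def \<pi>_v)
  show "finite outer" by (simp add: outer_def finite_darts)
  show "inj_on (corner_step E) outer"
    by (rule inj_on_subset[OF inj_on_corner_step]) (auto simp: outer_def)
  show "corner_step E ` outer \<subseteq> outer"
  proof
    fix g assume "g \<in> corner_step E ` outer"
    then obtain h where h: "h \<in> outer" "g = corner_step E h" by blast
    from h(1) show "g \<in> outer"
    proof (cases rule: outer_cases)
      case 2
      then show ?thesis using h(2) turn_D_x(1) by (simp add: corner_step_E outer_eq)
    qed (use h(2) in_outer corner_step_compare(1) in \<open>simp_all add: corner_step_E\<close>)
  qed
  show "\<pi> h \<in> darts D" if "h \<in> outer" for h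
    using that turn_D_x(1) xD \<pi>_\<rho> \<pi>_id[OF xD]
    by (cases rule: outer_cases) (simp_all add: \<pi>_v)
  show "\<rho> g \<in> outer" if "g \<in> darts D" for g
    using that by (rule orbit_E_\<rho>(1))
  show "orbit (corner_step D) (\<pi> (corner_step E h)) = orbit (corner_step D) (\<pi> h)" if "h \<in> outer" for h
    using that
  proof (cases rule: outer_cases)
    case (4 g)
    then show ?thesis using corner_step_compare(2) \<pi>_\<rho> orbit_D by simp
  qed (simp_all add: corner_step_E \<pi>_v \<pi>_id[OF xD] \<pi>_id[OF turn_D_x(1)])
  show "orbit (corner_step E) (\<rho> (corner_step D g)) = orbit (corner_step E) (\<rho> g)"
    if "g \<in> darts D" for g
    using corner_step_compare(3)[OF that] .
  show "orbit (corner_step E) (\<rho> (\<pi> h)) = orbit (corner_step E) h" if "h \<in> outer" for h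
    using that
  proof (cases rule: outer_cases)
    case 1
    then show ?thesis
      using orbit_E[of "(v, True)"] orbit_E[of "(v, False)"] orbit_E_\<rho>(2)[OF turn_D_x(1)]
      by (simp add: outer_eq corner_step_E \<pi>_v)
  next
    case 2
    then show ?thesis
      using orbit_E[of "(v, False)"] orbit_E_\<rho>(2)[OF turn_D_x(1)]
      by (simp add: outer_eq corner_step_E \<pi>_v)
  next
    case 3
    then show ?thesis using orbit_E_\<rho>(2)[OF xD] by (simp add: \<pi>_id[OF xD])
  next
    case (4 g)
    then show ?thesis using \<pi>_\<rho> by simp
  qed
  show "orbit (corner_step D) (\<pi> (\<rho> g)) = orbit (corner_step D) g" if "g \<in> darts D" for g
    using \<pi>_\<rho>[OF that] by simp
  show "finite (darts D)" by (rule finite_darts)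
  show "inj_on (corner_step D) (darts D)" by (rule inj_on_corner_step)
  show "corner_step D ` darts D \<subseteq> darts D" by (rule corner_step_darts[OF wf_D])
qed

lemma card_regions_E: "card (regions E) = card (regions D) + 1"
proof -
  let ?o = "orbit (corner_step E)"
  have monogon: "?o (v', False) = {(v', False)}"
    using corner_step_E(1) by (simp add: orbit_eq_singleton_iff)
  have "?o (v', False) \<notin> ?o ` outer"
  proof
    assume "?o (v', False) \<in> ?o ` outer"
    then obtain g where g: "g \<in> outer" "?o g = {(v', False)}" using monogon by auto
    have "g \<in> ?o g"
      using self_in_orbit_of_finite_injection[OF finite_darts inj_on_corner_step
        corner_step_darts[OF wf_E]] g(1) by (simp add: outer_def)
    then show False using g by (simp add: outer_def)
  qed
  moreover have "darts E = insert (v', False) outer" by (auto simp: outer_def darts_def set_passages_E)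
  then have "?o ` darts E = insert (?o (v', False)) (?o ` outer)" by simp
  moreover have "finite (?o ` outer)" by (simp add: outer_def finite_darts)
  ultimately have "card (?o ` darts E) = card (?o ` outer) + 1" by simp
  then show ?thesis by (simp add: card_regions wf_D wf_E card_orbits_outer)
qed

lemma twisted_E:
  assumes "twisted_diagram D"
  shows "twisted_diagram E"
proof -
  have "crossings E = insert c (crossings D)" by (auto simp: crossings_eq set_passages_E)
  then have "card (crossings E) = card (crossings D) + 1" using fresh by (simp add: D_def)
  moreover have "passages D \<noteq> []" "length (passages E) = length (passages D) + 2"
    by (simp_all add: passages_D passages_E)
  ultimately show ?thesis
    using assms wf_E by (simp add: twisted_diagram_def planar_def card_regions_E)
qed

end

section \<open>Gauss words of plane diagrams\<close>

lemma exists_strand_swap: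
  assumes "twisted_diagram (Code (x # y # W) k)" "x \<noteq> Bar" "y \<noteq> Bar" "crossing x \<noteq> crossing y"
  obtains t b where "strand_swap x y W k t b"
proof -
  let ?C = "crossings (Code (x # y # W) k)"
  obtain t where t: "t \<notin> ?C" using ex_new_if_finite[OF infinite_UNIV_nat, of ?C] by auto
  obtain b where b: "b \<notin> insert t ?C" using ex_new_if_finite[OF infinite_UNIV_nat, of "insert t ?C"] by auto
  have "strand_swap x y W k t b"
    using assms t b by unfold_locales (auto simp: twisted_diagram_def)
  then show thesis by (rule that)
qed

text \<open>
  The passage \<open>y\<close> is moved towards \<open>x\<close> by interchanging it with the virtual passage \<open>v\<close> before it. If
  \<open>mate v\<close> lies outside the segment \<open>V\<close>, then \<open>V\<close> becomes shorter. Otherwise two new virtual passages appear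
  in \<open>V\<close> around \<open>mate v\<close>, but their mates, which are next to \<open>mate y\<close>, do not lie in
  \<open>V\<close>, and neither does \<open>v\<close> any longer. So the length of \<open>V\<close> plus the number of passages in
  \<open>V\<close> whose mates are also in \<open>V\<close> decreases in either case.
\<close>

lemma make_passages_adjacent:
  assumes "twisted_diagram (Code (x # V @ y # U) k)"
    and "gauss_word k V = []" "x \<noteq> Bar" "y \<noteq> Bar" "crossing x \<noteq> crossing y"
    and "k (crossing x) \<noteq> Virtual" "k (crossing y) \<noteq> Virtual"
  shows "\<exists>U' k'. twisted_diagram (Code (x # y # U') k') \<and> gauss_word k' U' = gauss_word k U \<and>
    (\<forall>c \<in> crossings (Code (x # V @ y # U) k). k' c = k c)"
  using assms
proof (induction "length V + card {z \<in> set V. mate z \<in> set V}" arbitrary: V U k rule: less_induct)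
  case less
  show ?case
  proof (cases V rule: rev_cases)
    case Nil
    with less.prems show ?thesis by auto
  next
    case (snoc V0 v)
    have virtual: "z \<noteq> Bar" "k (crossing z) = Virtual" if "z \<in> set V" for z
      using less.prems(2) that by (auto simp: gauss_word_eq_Nil_iff)
    have v: "v \<noteq> Bar" "k (crossing v) = Virtual" using virtual snoc by auto
    let ?W = "U @ x # V0"
    have "twisted_diagram (Code ((v # y # U) @ (x # V0)) k)"
      using twisted_diagram_rotate[of "x # V0" "v # y # U" k] less.prems(1) by (simp add: snoc)
    then have tw: "twisted_diagram (Code (v # y # ?W) k)" by simp
    have "crossing v \<noteq> crossing y" using v(2) less.prems(7) by auto
    then obtain t b where "strand_swap v y ?W k t b"
      using exists_strand_swap[OF tw v(1) less.prems(4)] by blast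
    then interpret strand_swap v y ?W k t b .
    have tw_D: "twisted_diagram D" using tw by (simp add: D_def)
    let ?k = "kind E" and ?U = "v # concat (map block U)" and ?V = "concat (map block V0)"
    have x: "x \<noteq> v" "x \<noteq> y" "x \<noteq> mate v" "x \<noteq> mate y"
      using less.prems v by auto
    have word_E: "E = Code ((y # ?U) @ (x # ?V)) ?k"
      using x by (simp add: E_def) (simp add: block_def)
    have "word E = (y # ?U) @ (x # ?V)"
      using arg_cong[OF word_E, of word] by simp
    then have set_E: "set (word E) = set (x # ?V @ y # ?U)"
      by (simp only: set_append set_simps Un_insert_left Un_insert_right Un_commute insert_commute)
    have tw': "twisted_diagram (Code (x # ?V @ y # ?U) ?k)"
      using twisted_diagram_rotate[of "y # ?U" "x # ?V" ?k] twisted_E[OF tw_D] word_E by simp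
    have in_D: "crossing z \<in> crossings D" if "z \<in> set V \<union> {x, y}" for z
    proof -
      have "z \<in> set (passages D)"
        using that less.prems(3,4) virtual by (auto simp: D_def set_passages snoc)
      then show ?thesis by (simp add: crossings_eq)
    qed
    have V0: "z \<notin> {v, y, mate y}" if "z \<in> set V0" for z
    proof -
      have "v \<notin> set V0" using not_in_W by simp
      moreover have "k (crossing z) = Virtual" using virtual that snoc by simp
      ultimately show ?thesis using that less.prems(4,7) by auto
    qed
    have block_V0: "block z = (if z = mate v then [X (\<not> \<alpha>), z, X \<alpha>] else [z])" if "z \<in> set V0" for z
      using V0[OF that] by (auto simp: block_def)
    have blocks: "gauss_word ?k ?V = gauss_word k V0"
      "gauss_word ?k (concat (map block U)) = gauss_word k U"
      by (rule gauss_word_blocks, force)+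
    then have virtual': "gauss_word ?k ?V = []"
      using less.prems(2) by (simp add: snoc)
    have kind_xy: "?k (crossing x) = k (crossing x)" "?k (crossing y) = k (crossing y)"
      by (rule crossing_kind_E, rule in_D, simp)+
    have decrease: "length ?V + card {z \<in> set ?V. mate z \<in> set ?V} <
        length V + card {z \<in> set V. mate z \<in> set V}"
    proof (cases "mate v \<in> set V0")
      case True
      then obtain A B where AB: "V0 = A @ mate v # B" by (meson split_list)
      have "distinct V0"
      proof -
        have "filter (\<lambda>z. z \<noteq> Bar) V0 = V0"
          using virtual snoc by (intro filter_True) auto
        then show ?thesis using distinct_D by (auto simp: D_def passages_def split: if_splits)
      qed
      then have nAB: "mate v \<notin> set A" "mate v \<notin> set B" by (auto simp: AB)
      have "concat (map block L) = L" if "set L \<subseteq> set V0" "mate v \<notin> set L" for L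
        using that by (induction L) (auto simp: block_V0)
      moreover have set_V0: "set V0 = insert (mate v) (set A \<union> set B)"
        and length_V0: "length V0 = length A + length B + 1"
        by (simp_all add: AB)
      ultimately have "concat (map block A) = A" "concat (map block B) = B" using nAB by blast+
      moreover have "block (mate v) = [X (\<not> \<alpha>), mate v, X \<alpha>]"
        using block_V0[OF True] by simp
      ultimately have eq: "?V = A @ [X (\<not> \<alpha>), mate v, X \<alpha>] @ B"
        using arg_cong[OF AB, of "\<lambda>l. concat (map block l)"] by simp
      have sub: "{z \<in> set ?V. mate z \<in> set ?V} \<subseteq> {z \<in> set V. mate z \<in> set V} - {v, mate v}"
      proof
        fix z assume z: "z \<in> {z \<in> set ?V. mate z \<in> set ?V}"
        have inV: "w \<in> set V0 \<or> w \<in> range X" if "w \<in> set ?V" for w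
          using that by (auto simp: eq set_V0)
        have old: "w \<in> set (passages D)" if "w \<in> set V0" for w
          using that virtual[of w] by (auto simp: D_def set_passages snoc)
        have nY: "Y s \<notin> set ?V" for s
        proof
          assume "Y s \<in> set ?V"
          from inV[OF this] old[of "Y s"] show False by auto
        qed
        have nX: "z \<notin> range X"
        proof
          assume "z \<in> range X"
          then obtain s where "z = X s" by blast
          then have "Y s \<in> set ?V" using z by (simp del: set_concat)
          then show False using nY by blast
        qed
        then have z0: "z \<in> set V0" using inV z by blast
        then have "mate z \<in> set (passages D)" using old wf_D by simp
        then have "mate z \<notin> range X" by auto
        then have "mate z \<in> set V0" using inV z by blast
        moreover have "v \<notin> set V0" using V0 by blast
        ultimately show "z \<in> {z \<in> set V. mate z \<in> set V} - {v, mate v}"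
          using z0 by (auto simp: snoc)
      qed
      have two: "{v, mate v} \<subseteq> {z \<in> set V. mate z \<in> set V}" using True by (auto simp: snoc)
      have "card {z \<in> set ?V. mate z \<in> set ?V} \<le> card ({z \<in> set V. mate z \<in> set V} - {v, mate v})"
        by (rule card_mono[OF _ sub]) simp
      also have "\<dots> = card {z \<in> set V. mate z \<in> set V} - 2"
        using card_Diff_subset[OF _ two] v(1) by simp
      finally have "card {z \<in> set ?V. mate z \<in> set ?V} \<le> card {z \<in> set V. mate z \<in> set V} - 2" .
      moreover have "card {z \<in> set V. mate z \<in> set V} \<ge> 2"
        using card_mono[OF _ two] v(1) by simp
      moreover have "length ?V = length V + 1" by (simp add: eq length_V0 snoc)
      ultimately show ?thesis by linarith
    next
      case False
      have "concat (map block L) = L" if "set L \<subseteq> set V0" for L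
        using that False by (induction L) (auto simp: block_V0)
      then have eq: "?V = V0" by simp
      have "card {z \<in> set V0. mate z \<in> set V0} \<le> card {z \<in> set V. mate z \<in> set V}"
        by (rule card_mono) (auto simp: snoc)
      then show ?thesis by (simp add: eq snoc)
    qed
    obtain U' k' where *: "twisted_diagram (Code (x # y # U') k')" "gauss_word k' U' = gauss_word ?k ?U"
      "\<forall>c \<in> crossings (Code (x # ?V @ y # ?U) ?k). k' c = ?k c"
      using less.hyps[OF decrease tw' virtual' less.prems(3-5)] less.prems(6,7) kind_xy by auto
    have "gauss_word ?k ?U = gauss_word k U"
      using blocks(2) crossing_kind_E[OF in_D[of v]] v by (simp add: snoc)
    moreover have "k' c = k c" if c: "c \<in> crossings (Code (x # V @ y # U) k)" for c
    proof -
      have cD: "c \<in> crossings D" using c by (auto simp: crossings_def D_def snoc)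
      then have "c \<in> crossings E" by (simp add: crossings_E)
      then have "c \<in> crossings (Code (x # ?V @ y # ?U) ?k)"
        unfolding crossings_def set_E knot_code.sel .
      then show ?thesis using *(3) crossing_kind_E[OF cD] by simp
    qed
    ultimately show ?thesis using *(1,2) by auto
  qed
qed

text \<open>
  The function \<open>k\<close> prescribes the kinds of the chords of \<open>g\<close> once and for all, while the virtual
  crossings vary with the diagram.
\<close>

definition realizes :: "knot_code \<Rightarrow> letter list \<Rightarrow> (nat \<Rightarrow> kind) \<Rightarrow> bool" where
  "realizes D g k \<longleftrightarrow>
     twisted_diagram D \<and> gauss_word (kind D) (word D) = g \<and>
     (\<forall>c \<in> crossings (Code g k). kind D c = k c)"

lemma crossings_Code: "crossings (Code g k) = {c. \<exists>b. Pass c b \<in> set g}"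
  by (simp add: crossings_def)

lemma crossing_in_crossings:
  "z \<in> set g \<Longrightarrow> z \<noteq> Bar \<Longrightarrow> crossing z \<in> crossings (Code g k)"
  by (simp add: crossings_eq set_passages)

lemma realizes_kind:
  assumes "realizes D g k" "z \<in> set g" "z \<noteq> Bar"
  shows "kind D (crossing z) = k (crossing z)" "k (crossing z) \<noteq> Virtual"
proof -
  have "z \<in> set (gauss_word (kind D) (word D))" using assms by (simp add: realizes_def)
  then have "kind D (crossing z) \<noteq> Virtual" using assms(3) by (simp add: gauss_word_def)
  moreover have "crossing z \<in> crossings (Code g k)"
    using assms(2,3) by (rule crossing_in_crossings)
  ultimately show "kind D (crossing z) = k (crossing z)" "k (crossing z) \<noteq> Virtual"
    using assms(1) by (auto simp: realizes_def)
qed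

lemma realizes_word_mates:
  assumes "realizes D g k"
  shows "distinct (filter (\<lambda>z. z \<noteq> Bar) g)" "\<And>z. z \<in> set g \<Longrightarrow> mate z \<in> set g"
proof -
  have wf: "well_formed D" and g: "g = gauss_word (kind D) (word D)"
    using assms by (simp_all add: realizes_def twisted_diagram_def)
  have "filter (\<lambda>z. z \<noteq> Bar) g = filter (\<lambda>z. kind D (crossing z) \<noteq> Virtual) (passages D)"
    unfolding g gauss_word_def passages_def filter_filter by (rule filter_cong) auto
  then show "distinct (filter (\<lambda>z. z \<noteq> Bar) g)"
    using wf by (simp add: well_formed_def)
  show "mate z \<in> set g" if "z \<in> set g" for z
  proof (cases "z = Bar")
    case False
    then have "z \<in> set (passages D)" using that by (simp add: g gauss_word_def set_passages)
    then have "mate z \<in> set (passages D)" using wf by simp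
    then show ?thesis using that False by (simp add: g gauss_word_def set_passages)
  qed (use that in simp)
qed

lemma realizes_rotation_equiv:
  assumes "realizes D g k" "realizes D' (rotate n g) k"
  shows "reidemeister_equiv D D'"
proof -
  have "same_gauss (gauss D) (gauss D')"
    unfolding gauss_eq
  proof (rule same_gauss_refl)
    show "gauss_word (kind D') (word D') = rotate n (gauss_word (kind D) (word D))"
      using assms by (simp add: realizes_def)
    have "crossings (Code (rotate n g) k) = crossings (Code g k)"
      by (simp add: crossings_Code)
    then show "kind D' c = kind D c"
      if "c \<in> crossings (Code (gauss_word (kind D) (word D)) (kind D))" for c
      using assms that unfolding realizes_def crossings_Code by simp
  qed
  then have "gauss_move (gauss D) (gauss D')" by (rule gauss_move.same)
  then show ?thesis
    using assms by (simp add: reidemeister_equiv_def realizes_def r_into_equivclp)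
qed

definition unknotting_step :: "knot_code \<Rightarrow> knot_code \<Rightarrow> bool" where
  "unknotting_step X Y \<longleftrightarrow> reidemeister_equiv X Y \<or> region_arc_shift X Y"

text \<open>
  Whole Gauss words, with their base points and labels, are tracked, and each must be the Gauss word of a
  plane diagram: a region arc shift leads from one plane diagram to another.
\<close>

definition reachable :: "knot_code \<Rightarrow> letter list \<Rightarrow> bool" where
  "reachable D g \<longleftrightarrow>
     (\<exists>D'. unknotting_step\<^sup>*\<^sup>* D D' \<and>
           realizes D' g (kind D))"

lemma reachable_step:
  assumes "reachable D g" "\<And>A. realizes A g (kind D) \<Longrightarrow> unknotting_step A B"
    and "realizes B h (kind D)"
  shows "reachable D h"
proof -
  obtain A where "unknotting_step\<^sup>*\<^sup>* D A" "realizes A g (kind D)"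
    using assms(1) unfolding reachable_def by blast
  then have "unknotting_step\<^sup>*\<^sup>* D B"
    using assms(2) by (blast intro: rtranclp.rtrancl_into_rtrancl)
  then show ?thesis using assms(3) unfolding reachable_def by blast
qed

lemma reachable_realization:
  assumes "reachable D g" "realizes A g (kind D)" "region_arc_shift A B" "realizes B h (kind D)"
  shows "reachable D h"
proof -
  obtain A' where A': "unknotting_step\<^sup>*\<^sup>* D A'" "realizes A' g (kind D)"
    using assms(1) unfolding reachable_def by blast
  have "unknotting_step A' A" "unknotting_step A B"
    using realizes_rotation_equiv[OF A'(2), of A 0] assms(2,3) by (simp_all add: unknotting_step_def)
  with A'(1) have "unknotting_step\<^sup>*\<^sup>* D B"
    by (blast intro: rtranclp.rtrancl_into_rtrancl)
  with assms(4) show ?thesis unfolding reachable_def by blast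
qed

lemma realizes_rotate:
  assumes "realizes D (g @ h) k"
  obtains D' where "realizes D' (h @ g) k"
proof -
  obtain u v where w: "word D = u @ v" "gauss_word (kind D) u = g" "gauss_word (kind D) v = h"
    using assms gauss_word_eq_appendD unfolding realizes_def by blast
  have "twisted_diagram (Code (u @ v) (kind D))"
    using assms w(1) by (metis knot_code.collapse realizes_def)
  then have "twisted_diagram (Code (v @ u) (kind D))" by (rule twisted_diagram_rotate)
  then have "realizes (Code (v @ u) (kind D)) (h @ g) k"
    using assms w(2,3) by (auto simp: realizes_def crossings_Code)
  then show thesis by (rule that)
qed

lemma reachable_rotate:
  assumes "reachable D (g @ h)"
  shows "reachable D (h @ g)"
proof -
  obtain A where "realizes A (g @ h) (kind D)" using assms unfolding reachable_def by blast
  then obtain B where B: "realizes B (h @ g) (kind D)" by (rule realizes_rotate)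
  show ?thesis
  proof (rule reachable_step[OF assms _ B])
    fix A assume "realizes A (g @ h) (kind D)"
    then show "unknotting_step A B"
      using realizes_rotation_equiv[of A "g @ h" "kind D" B "length g"] B
      by (simp add: rotate_append unknotting_step_def)
  qed
qed

lemma reachable_cancel_bars:
  assumes "reachable D (Bar # Bar # g)"
  shows "reachable D g"
proof -
  obtain A where A: "unknotting_step\<^sup>*\<^sup>* D A"
      "realizes A (Bar # Bar # g) (kind D)"
    using assms unfolding reachable_def by blast
  let ?k = "kind A"
  have gw: "gauss_word ?k (word A) = Bar # Bar # g" using A(2) by (simp add: realizes_def)
  then obtain u v where u: "word A = u @ Bar # v" "gauss_word ?k u = []" "gauss_word ?k v = Bar # g"
    by (rule gauss_word_eq_ConsD)
  from u(3) obtain v1 v2 where v: "v = v1 @ Bar # v2" "gauss_word ?k v1 = []" "gauss_word ?k v2 = g"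
    by (rule gauss_word_eq_ConsD)
  let ?B = "Code (u @ v1 @ v2) ?k"
  have "twisted_diagram ?B"
    by (rule twisted_diagram_cong[of A _ 0]) (use A(2) u(1) v(1) in \<open>simp_all add: realizes_def passages_def\<close>)
  moreover have gB: "gauss_word ?k (u @ v1 @ v2) = g" using u v by simp
  ultimately have B: "realizes ?B g (kind D)"
    using A(2) by (auto simp: realizes_def crossings_Code)
  have "gauss_move (Code g ?k) (Code ([Bar, Bar] @ g) ?k)" by (rule gauss_move.T2)
  then have "equivclp gauss_move (gauss ?B) (gauss A)"
    using gB gw by (simp add: gauss_eq r_into_equivclp)
  then have "reidemeister_equiv A ?B"
    using A(2) B by (simp add: reidemeister_equiv_def realizes_def equivclp_sym)
  with A(1) have "unknotting_step\<^sup>*\<^sup>* D ?B"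
    by (simp add: rtranclp.rtrancl_into_rtrancl unknotting_step_def)
  with B show ?thesis unfolding reachable_def by blast
qed

text \<open>
  Swapping the strands once gives a plane diagram \<open>first.E\<close> with the desired Gauss word, and swapping them once
  more gives a diagram \<open>second.E\<close> with the given one. The region arc shift, which undoes a
  swap, leads from the latter to the former.
\<close>

lemma reachable_swap_passages:
  assumes reach: "reachable D (x # y # g)" and proper: "x \<noteq> Bar" "y \<noteq> Bar" "crossing x \<noteq> crossing y"
  shows "reachable D (y # x # g)"
proof -
  obtain A where A: "realizes A (x # y # g) (kind D)" using reach unfolding reachable_def by blast
  let ?k = "kind A"
  have gw: "gauss_word ?k (word A) = x # y # g" using A by (simp add: realizes_def)
  then obtain u v where u: "word A = u @ x # v" "gauss_word ?k u = []" "gauss_word ?k v = y # g"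
    by (rule gauss_word_eq_ConsD)
  from u(3) obtain V w where v: "v = V @ y # w" "gauss_word ?k V = []" "gauss_word ?k w = g"
    by (rule gauss_word_eq_ConsD)
  have "twisted_diagram (Code (u @ (x # V @ y # w)) ?k)"
    using A u(1) v(1) by (metis knot_code.collapse realizes_def)
  from twisted_diagram_rotate[OF this]
  have tw: "twisted_diagram (Code (x # V @ y # (w @ u)) ?k)" by simp
  have kind: "?k (crossing x) \<noteq> Virtual" "?k (crossing y) \<noteq> Virtual"
    using realizes_kind[OF A, of x] realizes_kind[OF A, of y] proper by auto
  obtain W k where W: "twisted_diagram (Code (x # y # W) k)"
      "gauss_word k W = gauss_word ?k (w @ u)"
      "\<forall>c \<in> crossings (Code (x # V @ y # (w @ u)) ?k). k c = ?k c"
    using make_passages_adjacent[OF tw v(2) proper kind] by blast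
  have gW: "gauss_word k W = g" using W(2) u(2) v(3) by simp
  have k: "k c = kind D c" if c: "c \<in> crossings (Code (x # y # g) (kind D))" for c
  proof -
    have "c \<in> crossings (Code (x # V @ y # (w @ u)) ?k)"
      using c v(3) by (auto simp: crossings_Code gauss_word_def)
    then show ?thesis using W(3) A c by (simp add: realizes_def)
  qed
  have kxy: "k (crossing x) \<noteq> Virtual" "k (crossing y) \<noteq> Virtual"
  proof -
    have "crossing z \<in> crossings (Code (x # y # g) (kind D))" if "z \<in> {x, y}" for z
      using that proper by (intro crossing_in_crossings) auto
    then have "k (crossing x) = kind D (crossing x)" "k (crossing y) = kind D (crossing y)"
      using k by simp_all
    then show "k (crossing x) \<noteq> Virtual" "k (crossing y) \<noteq> Virtual"
      using realizes_kind[OF A, of x] realizes_kind[OF A, of y] proper by simp_all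
  qed
  obtain t b where "strand_swap x y W k t b"
    using exists_strand_swap[OF W(1) proper] by blast
  then interpret first: strand_swap x y W k t b .
  let ?W = "concat (map first.block W)" and ?k1 = "kind first.E"
  have E1: "first.E = Code (y # x # ?W) ?k1" by (simp add: first.E_def)
  have tw1: "twisted_diagram first.E"
    using first.twisted_E W(1) by (simp add: first.D_def)
  have k1: "?k1 c = k c" if "c \<in> crossings (Code (x # y # W) k)" for c
    using first.crossing_kind_E that by (simp add: first.D_def)
  have gW1: "gauss_word ?k1 ?W = g" using first.gauss_word_blocks[of W] gW by simp
  have sub: "crossings (Code (x # y # g) (kind D)) \<subseteq> crossings (Code (x # y # W) k)"
    using gW by (auto simp: crossings_Code gauss_word_def)
  have kxy1: "?k1 (crossing x) \<noteq> Virtual" "?k1 (crossing y) \<noteq> Virtual"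
    using kxy first.kind_E_old[OF first.x_y_in(1)] first.kind_E_old[OF first.x_y_in(2)] by simp_all
  have B: "realizes first.E (y # x # g) (kind D)"
    unfolding realizes_def
  proof (intro conjI ballI tw1)
    show "gauss_word ?k1 (word first.E) = y # x # g"
      using kxy1 gW1 by (subst E1) simp
    fix c assume "c \<in> crossings (Code (y # x # g) (kind D))"
    then have "c \<in> crossings (Code (x # y # g) (kind D))" by (auto simp: crossings_Code)
    then show "?k1 c = kind D c" using k k1 sub by auto
  qed
  have "crossing y \<noteq> crossing x" using proper(3) by simp
  then obtain t' b' where "strand_swap y x ?W ?k1 t' b'"
    using exists_strand_swap[of y x ?W ?k1] tw1 E1 proper by metis
  then interpret second: strand_swap y x ?W ?k1 t' b' .
  have D2: "second.D = first.E" using E1 by (simp add: second.D_def)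
  let ?W2 = "concat (map second.block ?W)" and ?k2 = "kind second.E"
  have E2: "second.E = Code (x # y # ?W2) ?k2" by (simp add: second.E_def)
  have "realizes second.E (x # y # g) (kind D)"
    unfolding realizes_def
  proof (intro conjI ballI)
    show "twisted_diagram second.E" using second.twisted_E tw1 D2 by simp
    show "gauss_word ?k2 (word second.E) = x # y # g"
      using kxy1 second.gauss_word_blocks[of ?W] gW1 second.kind_E_old[OF second.x_y_in(1)]
        second.kind_E_old[OF second.x_y_in(2)] proper
      by (subst E2) simp
    fix c assume c: "c \<in> crossings (Code (x # y # g) (kind D))"
    then have "c \<in> crossings first.E"
      using sub first.crossings_E by (auto simp: first.D_def)
    then have "?k2 c = ?k1 c" using second.crossing_kind_E D2 by simp
    then show "?k2 c = kind D c" using k k1 sub c by auto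
  qed
  moreover have "region_arc_shift second.E first.E"
    using second.region_arc_shift_undoes_swap tw1 D2 by simp
  ultimately show ?thesis
    using reachable_realization[OF reach _ _ B] by blast
qed

text \<open>
  Next to \<open>x = mate z\<close> a virtual kink is inserted, and the strands at \<open>x\<close> and at the first
  passage \<open>v\<close> of the kink are swapped. The arc of the triangle that starts at \<open>z\<close> leads to a virtual passage,
  and the bar is put on it. The region arc shift moves \<open>z\<close> to the other end of the arc, behind the bar; the
  interchange of \<open>x\<close> and \<open>v\<close> has no effect on the Gauss word as \<open>v\<close> is virtual.
\<close>

lemma reachable_bar_across_passage:
  assumes reach: "reachable D (z # Bar # g)" and z: "z \<noteq> Bar"
  shows "reachable D (Bar # z # g)"
proof -
  obtain A where A: "realizes A (z # Bar # g) (kind D)" using reach unfolding reachable_def by blast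
  let ?k = "kind A"
  have gw: "gauss_word ?k (word A) = z # Bar # g" using A by (simp add: realizes_def)
  then obtain u w where u: "word A = u @ z # w" "gauss_word ?k u = []" "gauss_word ?k w = Bar # g"
    by (rule gauss_word_eq_ConsD)
  from u(3) obtain s r where s: "w = s @ Bar # r" "gauss_word ?k s = []" "gauss_word ?k r = g"
    by (rule gauss_word_eq_ConsD)
  define x where "x = mate z"
  have x: "x \<noteq> Bar" "mate x = z" "x \<noteq> z" "crossing x = crossing z" using z by (simp_all add: x_def)
  have kz: "?k (crossing z) \<noteq> Virtual" using realizes_kind[OF A, of z] z by simp
  have "x \<in> set (z # Bar # g)" using realizes_word_mates(2)[OF A, of z] by (simp add: x_def)
  then have "x \<in> set g" using x(1,3) by simp
  then have "x \<in> set (gauss_word ?k r)" unfolding s(3) .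
  then have "x \<in> set (s @ r @ u)" by (simp add: gauss_word_def)
  then obtain r1 r2 where r: "s @ r @ u = r1 @ x # r2" by (meson split_list)
  let ?g1 = "gauss_word ?k r1" and ?g2 = "gauss_word ?k r2"
  have g: "g = ?g1 @ x # ?g2"
    using arg_cong[OF r, of "gauss_word ?k"] u(2) s(2,3) kz x by simp
  have "twisted_diagram (Code (z # Bar # (s @ r @ u)) ?k)"
  proof (rule twisted_diagram_cong[where D = A and n = "length (passages (Code u ?k))"])
    show "twisted_diagram A" using A by (simp add: realizes_def)
    have "passages A = passages (Code u ?k) @ z # passages (Code s ?k) @ passages (Code r ?k)"
      using u(1) s(1) z by (simp add: passages_def)
    then show "passages (Code (z # Bar # (s @ r @ u)) ?k) =
        rotate (length (passages (Code u ?k))) (passages A)"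
      using z by (simp add: rotate_append) (simp add: passages_def)
  qed simp
  then have "twisted_diagram (Code ((z # Bar # r1) @ (x # r2)) ?k)" by (simp add: r)
  from twisted_diagram_rotate[OF this]
  have tw: "twisted_diagram (Code (x # r2 @ z # Bar # r1) ?k)" by simp
  let ?C = "crossings (Code (x # r2 @ z # Bar # r1) ?k)"
  obtain c where c: "c \<notin> ?C" using ex_new_if_finite[OF infinite_UNIV_nat, of ?C] by auto
  have "virtual_kink x (r2 @ z # Bar # r1) ?k c"
    using tw c x(1) by unfold_locales (simp_all add: twisted_diagram_def)
  then interpret kink: virtual_kink x "r2 @ z # Bar # r1" ?k c .
  define v where "v = Pass c True"
  define v' where "v' = Pass c False"
  let ?k3 = "?k(c := Virtual)" and ?W = "v' # r2 @ z # Bar # r1"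
  have v: "v \<noteq> Bar" "crossing v = c" "v' \<noteq> Bar" "crossing v' = c" by (simp_all add: v_def v'_def)
  have tw3: "twisted_diagram (Code (x # v # ?W) ?k3)"
    using kink.twisted_E tw by (simp add: kink.D_def kink.E_def v_def v'_def)
  have "crossing x \<in> ?C" using x by (intro crossing_in_crossings) auto
  then have xc: "crossing x \<noteq> c" using c by auto
  then obtain t b where "strand_swap x v ?W ?k3 t b"
    using exists_strand_swap[OF tw3 x(1) v(1)] v(2) by auto
  then interpret sw: strand_swap x v ?W ?k3 t b .
  define kE where "kE = kind sw.E"
  define B1 where "B1 = concat (map sw.block (v' # r2))"
  define B2 where "B2 = concat (map sw.block r1)"
  define X1 where "X1 = sw.X (\<not> sw.\<alpha>)"
  define X2 where "X2 = sw.X sw.\<alpha>"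
  have X_neq: "X1 \<noteq> Bar" "X2 \<noteq> Bar" and kX: "kE (crossing X1) = Virtual" "kE (crossing X2) = Virtual"
    by (simp_all add: X1_def X2_def kE_def)
  have block_z: "sw.block z = [X1, z, X2]" using sw.block_mate_x unfolding x(2) X1_def X2_def .
  have "concat (map sw.block ?W) = B1 @ [X1, z, X2, Bar] @ B2"
    by (simp add: block_z sw.block_Bar B1_def B2_def)
  then have E: "word sw.E = v # x # B1 @ [X1, z, X2, Bar] @ B2"
    by (simp add: sw.E_def)
  \<comment> \<open>Two words with the plane graph of the swapped diagram; V1 has the bar on the arc
    from z to X2 that is to be shifted, and V2 represents the outcome.\<close>
  define V1 where "V1 = v # x # B1 @ [X1, z, Bar, X2] @ B2"
  define V2 where "V2 = v # x # B1 @ [Bar, X1, z, X2] @ B2"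
  have passages: "passages (Code V1 kE) = passages sw.E" "passages (Code V2 kE) = passages sw.E"
    unfolding passages_def knot_code.sel E V1_def V2_def using X_neq z by simp_all
  have tw_E: "twisted_diagram sw.E" using sw.twisted_E tw3 by (simp add: sw.D_def)
  have tw_V: "twisted_diagram (Code V1 kE)" "twisted_diagram (Code V2 kE)"
    using twisted_diagram_cong[OF tw_E, of "Code V1 kE" 0]
      twisted_diagram_cong[OF tw_E, of "Code V2 kE" 0] passages
    by (simp_all only: rotate0 id_apply knot_code.sel kE_def)
  have old: "?k3 (crossing y) = ?k (crossing y)" if "y \<in> set (x # r2 @ z # Bar # r1)" "y \<noteq> Bar" for y
    using crossing_in_crossings[OF that, of ?k] c by auto
  have "gauss_word ?k3 (v' # r2) = gauss_word ?k3 r2" using v by simp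
  also have "\<dots> = ?g2" by (rule gauss_word_cong) (use old in auto)
  finally have g2: "gauss_word ?k3 (v' # r2) = ?g2" .
  have g1: "gauss_word ?k3 r1 = ?g1" by (rule gauss_word_cong) (use old in auto)
  have sub: "set (v' # r2) \<subseteq> set ?W" "set r1 \<subseteq> set ?W" by auto
  have blocks: "gauss_word kE B1 = ?g2" "gauss_word kE B2 = ?g1"
    using sw.gauss_word_blocks[OF sub(1)] sw.gauss_word_blocks[OF sub(2)] g1 g2
    unfolding B1_def B2_def kE_def by simp_all
  have shifted: "gauss_word kE (map sw.shift B1) = ?g2" "gauss_word kE (map sw.shift B2) = ?g1"
    using sw.gauss_word_shift_blocks[OF sub(1)] sw.gauss_word_shift_blocks[OF sub(2)] g1 g2
    unfolding B1_def B2_def kE_def by simp_all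
  have kE: "kE e = ?k e" if "e \<in> ?C" for e
  proof -
    have "e \<in> crossings sw.D" using that by (auto simp: crossings_Code sw.D_def)
    then have "kE e = ?k3 e" unfolding kE_def by (rule sw.crossing_kind_E)
    then show ?thesis using that c by auto
  qed
  have "crossing z \<in> ?C" using \<open>crossing x \<in> ?C\<close> x(4) by simp
  then have kz_E: "kE (crossing z) \<noteq> Virtual" "kE (crossing x) \<noteq> Virtual"
    using kE kz x(4) by simp_all
  have kv_E: "kE (crossing v) = Virtual"
    using sw.kind_E_old[OF sw.x_y_in(2)] v(2) unfolding kE_def by simp
  have shift_simps: "sw.shift v = x" "sw.shift x = v" "sw.shift z = X2" "sw.shift X2 = z"
    "sw.shift X1 = X1" "sw.shift Bar = Bar"
    using sw.shift_simps unfolding x(2) X1_def X2_def by blast+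
  have gV1: "gauss_word kE V1 = x # ?g2 @ [z, Bar] @ ?g1"
    unfolding V1_def using kz_E kv_E kX X_neq v(1) x(1) z blocks by simp
  have gV2: "gauss_word kE V2 = x # ?g2 @ [Bar, z] @ ?g1"
    unfolding V2_def using kz_E kv_E kX X_neq v(1) x(1) z blocks by simp
  have "gauss_word kE (map sw.shift V1) = x # ?g2 @ [Bar, z] @ ?g1"
    unfolding V1_def map_append list.map shift_simps
    using kz_E kv_E kX X_neq v(1) x(1) z shifted by simp
  then have "gauss (Code (map sw.shift V1) kE) = gauss (Code V2 kE)"
    by (simp add: gauss_eq gV2)
  moreover have "same_gauss (gauss (Code V2 kE)) (gauss (Code V2 kE))"
    unfolding gauss_eq by (rule same_gauss_refl[where n = 0]) simp_all
  ultimately have ras: "region_arc_shift (Code V1 kE) (Code V2 kE)"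
    using sw.region_arc_shift_at_triangle[folded kE_def, OF passages(1) tw_V] by simp
  have kD: "kE e = kind D e" if "e \<in> crossings (Code (z # Bar # g) (kind D))" for e
  proof -
    have "e \<in> ?C" using that unfolding g by (auto simp: crossings_Code gauss_word_def)
    then show ?thesis using kE A that by (simp add: realizes_def)
  qed
  have "crossings (Code (x # ?g2 @ [z, Bar] @ ?g1) (kind D)) = crossings (Code (z # Bar # g) (kind D))"
    "crossings (Code (x # ?g2 @ [Bar, z] @ ?g1) (kind D)) = crossings (Code (z # Bar # g) (kind D))"
    unfolding g crossings_Code by auto
  then have "realizes (Code V1 kE) (x # ?g2 @ [z, Bar] @ ?g1) (kind D)"
    "realizes (Code V2 kE) (x # ?g2 @ [Bar, z] @ ?g1) (kind D)"
    unfolding realizes_def knot_code.sel using tw_V gV1 gV2 kD by simp_all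
  moreover have "reachable D ((x # ?g2) @ [z, Bar] @ ?g1)"
    using reachable_rotate[of D "[z, Bar] @ ?g1" "x # ?g2"] reach by (simp add: g)
  ultimately have "reachable D ((x # ?g2) @ [Bar, z] @ ?g1)"
    using reachable_realization[OF _ _ ras] by simp
  from reachable_rotate[OF this] show ?thesis by (simp add: g)
qed

section \<open>Unknotting\<close>

lemma reachable_swap_within:
  assumes "reachable D (u @ [x, y] @ w)" "x \<noteq> Bar" "y \<noteq> Bar" "crossing x \<noteq> crossing y"
  shows "reachable D (u @ [y, x] @ w)"
proof -
  have "reachable D (x # y # (w @ u))" using reachable_rotate[OF assms(1)] by simp
  then have "reachable D ((y # x # w) @ u)" using reachable_swap_passages assms(2-4) by simp
  from reachable_rotate[OF this] show ?thesis by simp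
qed

lemma reachable_bar_within:
  assumes "reachable D (u @ [z, Bar] @ w)" "z \<noteq> Bar"
  shows "reachable D (u @ [Bar, z] @ w)"
proof -
  have "reachable D (z # Bar # (w @ u))" using reachable_rotate[OF assms(1)] by simp
  then have "reachable D ((Bar # z # w) @ u)" using reachable_bar_across_passage assms(2) by simp
  from reachable_rotate[OF this] show ?thesis by simp
qed

lemma reachable_bars_across_passage:
  assumes "reachable D (u @ z # replicate n Bar @ w)" "z \<noteq> Bar"
  shows "reachable D (u @ replicate n Bar @ z # w)"
  using assms(1)
proof (induction n arbitrary: u)
  case (Suc n)
  have "reachable D ((u @ [Bar]) @ z # replicate n Bar @ w)"
    using reachable_bar_within[of D u z "replicate n Bar @ w"] Suc.prems assms(2) by simp
  from Suc.IH[OF this] show ?case by simp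
qed simp

lemma reachable_gather_bars:
  assumes "reachable D (u @ g)"
  shows "\<exists>n. reachable D (u @ replicate n Bar @ filter (\<lambda>z. z \<noteq> Bar) g)"
  using assms
proof (induction g arbitrary: u)
  case Nil
  then show ?case by (intro exI[of _ 0]) simp
next
  case (Cons z g)
  then have "reachable D ((u @ [z]) @ g)" by simp
  from Cons.IH[OF this] obtain n
    where n: "reachable D (u @ z # replicate n Bar @ filter (\<lambda>z. z \<noteq> Bar) g)" by auto
  show ?case
  proof (cases "z = Bar")
    case True
    then show ?thesis using n by (intro exI[of _ "Suc n"]) simp
  next
    case False
    then show ?thesis using reachable_bars_across_passage[OF n] by (intro exI[of _ n]) simp
  qed
qed

text \<open>The parity of the number of bars decides which of the two trivial knots is reached.\<close>

lemma reachable_reduce_bars: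
  assumes "reachable D (replicate n Bar @ g)"
  shows "reachable D (replicate (n mod 2) Bar @ g)"
  using assms
proof (induction n rule: nat_induct2)
  case (step n)
  have "reachable D (Bar # Bar # replicate n Bar @ g)" using step.prems by simp
  then have "reachable D (replicate n Bar @ g)" by (rule reachable_cancel_bars)
  with step.IH show ?case by simp
qed simp_all

lemma reachable_passage_to_front:
  assumes "reachable D (u @ v @ [z] @ w)" "z \<noteq> Bar"
    and "\<And>y. y \<in> set v \<Longrightarrow> y \<noteq> Bar \<and> crossing y \<noteq> crossing z"
  shows "reachable D (u @ [z] @ v @ w)"
  using assms(1,3)
proof (induction v arbitrary: w rule: rev_induct)
  case (snoc y v)
  have "reachable D ((u @ v) @ [z, y] @ w)"
    by (rule reachable_swap_within) (use snoc.prems assms(2) in auto)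
  then have "reachable D (u @ v @ [z] @ (y # w))" by simp
  from snoc.IH[OF this] snoc.prems(2) show ?case by simp
qed simp

text \<open>The words of diagrams that the inverse of \<open>R1\<close> empties, chord by chord.\<close>

inductive isolated_chords :: "letter list \<Rightarrow> bool" where
  Nil: "isolated_chords []"
| Cons: "isolated_chords (Pass c b # Pass c (\<not> b) # g)"
    if "isolated_chords g" "c \<notin> crossing ` set g"

text \<open>
  The prefix \<open>u\<close> collects the chords that have been dealt with, so that the second endpoint of the next chord
  only has to move within the rest of the word.
\<close>

lemma reachable_isolate_chords:
  assumes "reachable D (u @ g)" "Bar \<notin> set g" "distinct g" "\<And>z. z \<in> set g \<Longrightarrow> mate z \<in> set g"
  shows "\<exists>h. isolated_chords h \<and> set h = set g \<and> reachable D (u @ h)"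
  using assms
proof (induction "length g" arbitrary: u g rule: less_induct)
  case less
  show ?case
  proof (cases g)
    case Nil
    then show ?thesis using less.prems isolated_chords.Nil by auto
  next
    case (Cons x g')
    have x: "x \<noteq> Bar" using less.prems(2) Cons by auto
    then have "mate x \<in> set g'" using less.prems(4)[of x] Cons mate_neq[of x] by auto
    then obtain v w where v: "g' = v @ mate x # w" by (meson split_list)
    have other: "y \<noteq> Bar \<and> crossing y \<noteq> crossing x" if "y \<in> set (v @ w)" for y
    proof -
      have "y \<noteq> Bar" "y \<noteq> x" "y \<noteq> mate x"
        using that less.prems(2,3) by (auto simp: Cons v)
      then show ?thesis using crossing_eq_iff[OF _ x, of y] by simp
    qed
    have "reachable D ((u @ [x]) @ v @ [mate x] @ w)"
      using less.prems(1) by (simp add: Cons v)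
    then have "reachable D ((u @ [x]) @ [mate x] @ v @ w)"
      by (rule reachable_passage_to_front) (use x other in auto)
    then have reach: "reachable D ((u @ [x, mate x]) @ (v @ w))" by simp
    have "mate y \<in> set (v @ w)" if "y \<in> set (v @ w)" for y
    proof -
      have "mate y \<in> set g" using less.prems(4)[of y] that by (auto simp: Cons v)
      moreover have "mate y \<noteq> x" "mate y \<noteq> mate x"
        using other[OF that] x by auto
      ultimately show ?thesis by (auto simp: Cons v)
    qed
    then obtain h where h: "isolated_chords h" "set h = set (v @ w)"
        "reachable D ((u @ [x, mate x]) @ h)"
      using less.hyps[OF _ reach] less.prems(2,3) by (auto simp: Cons v)
    obtain c b where xc: "x = Pass c b" using x by (cases x) auto
    have "c \<notin> crossing ` set h" using other xc by (auto simp: h(2))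
    then have "isolated_chords (x # mate x # h)"
      using isolated_chords.Cons[OF h(1), of c b] xc by simp
    moreover have "set (x # mate x # h) = set g" using h(2) by (auto simp: Cons v)
    moreover have "reachable D (u @ x # mate x # h)" using h(3) by simp
    ultimately show ?thesis by blast
  qed
qed

lemma gauss_move_isolated_chords:
  assumes "isolated_chords g" "\<And>z. z \<in> set g \<Longrightarrow> k (crossing z) \<noteq> Virtual" "set w \<subseteq> {Bar}"
  shows "equivclp gauss_move (Code (g @ w) k) (Code w k)"
  using assms(1,2)
proof induction
  case (Cons g c b)
  have "c \<notin> crossings (Code (g @ w) k)"
    using Cons.hyps(2) assms(3) by (force simp: crossings_def)
  moreover obtain s where "k c = Classical s"
    using Cons.prems[of "Pass c b"] by (cases "k c") auto
  ultimately have "gauss_move (Code (g @ w) k) (Code ([Pass c b, Pass c (\<not> b)] @ (g @ w)) k)"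
    by (rule gauss_move.R1)
  then have "equivclp gauss_move (Code ((Pass c b # Pass c (\<not> b) # g) @ w) k) (Code (g @ w) k)"
    by (simp add: r_into_equivclp equivclp_sym)
  moreover have "equivclp gauss_move (Code (g @ w) k) (Code w k)"
    using Cons.IH Cons.prems by simp
  ultimately show ?case by (rule equivclp_trans)
qed simp

lemma trivial_knot_diagram_of_isolated_chords:
  assumes "realizes D (g @ replicate n Bar) k" "isolated_chords g" "n < 2"
  shows "trivial_knot_diagram D"
proof -
  let ?w = "replicate n Bar"
  have "kind D (crossing z) \<noteq> Virtual" if "z \<in> set g" for z
  proof -
    have "z \<noteq> Bar" using assms(2) that by induction auto
    then show ?thesis using realizes_kind[OF assms(1), of z] that by simp
  qed
  then have "equivclp gauss_move (Code (g @ ?w) (kind D)) (Code ?w (kind D))"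
    using assms(2) by (intro gauss_move_isolated_chords) auto
  moreover have "same_gauss (Code ?w (kind D)) (Code ?w (\<lambda>_. Virtual))"
    by (rule same_gauss_refl[where n = 0]) (simp_all add: crossings_def)
  then have "equivclp gauss_move (Code ?w (kind D)) (Code ?w (\<lambda>_. Virtual))"
    by (intro r_into_equivclp gauss_move.same)
  ultimately have "equivclp gauss_move (Code (g @ ?w) (kind D)) (Code ?w (\<lambda>_. Virtual))"
    by (rule equivclp_trans)
  moreover have "gauss D = Code (g @ ?w) (kind D)"
    using assms(1) by (simp add: gauss_eq realizes_def)
  moreover have "gauss (Code ?w (\<lambda>_. Virtual)) = Code ?w (\<lambda>_. Virtual)"
    by (simp add: gauss_def)
  moreover have "twisted_diagram (Code ?w (\<lambda>_. Virtual))"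
    by (simp add: twisted_diagram_def well_formed_def planar_def passages_def)
  ultimately have "reidemeister_equiv D (Code ?w (\<lambda>_. Virtual))"
    using assms(1) by (simp add: reidemeister_equiv_def realizes_def)
  moreover have "?w = [] \<or> ?w = [Bar]"
    using assms(3) by (cases n) auto
  ultimately show ?thesis by (auto simp: trivial_knot_diagram_def)
qed

theorem theorem4p5:
  fixes D :: knot_code
  assumes "twisted_diagram D"
  shows "\<exists>D'. (\<lambda>X Y. reidemeister_equiv X Y \<or> region_arc_shift X Y)\<^sup>*\<^sup>* D D' \<and>
              trivial_knot_diagram D'"
proof -
  let ?g = "gauss_word (kind D) (word D)"
  let ?p = "filter (\<lambda>z. z \<noteq> Bar) ?g"
  have D: "realizes D ?g (kind D)" using assms by (simp add: realizes_def)
  then have "reachable D ([] @ ?g)" by (auto simp: reachable_def)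
  then obtain n where "reachable D (replicate n Bar @ ?p)"
    using reachable_gather_bars by fastforce
  then have reach: "reachable D (replicate (n mod 2) Bar @ ?p)" by (rule reachable_reduce_bars)
  have "mate z \<in> set ?p" if "z \<in> set ?p" for z
    using realizes_word_mates(2)[OF D, of z] that by simp
  then obtain h where h: "isolated_chords h" "reachable D (replicate (n mod 2) Bar @ h)"
    using reachable_isolate_chords[OF reach] realizes_word_mates(1)[OF D] by auto
  then obtain D' where D': "unknotting_step\<^sup>*\<^sup>* D D'" "realizes D' (h @ replicate (n mod 2) Bar) (kind D)"
    using reachable_rotate unfolding reachable_def by blast
  have "trivial_knot_diagram D'"
    by (rule trivial_knot_diagram_of_isolated_chords[OF D'(2) h(1)]) simp
  moreover have "unknotting_step = (\<lambda>X Y. reidemeister_equiv X Y \<or> region_arc_shift X Y)"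
    by (intro ext) (simp add: unknotting_step_def)
  ultimately show ?thesis using D'(1) by auto
qed

end
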